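(* Let $1<p,q<\infty$, let $\mathbb X=\ell^p(\ell^q)$ and let $\mathcal D$ be its canonical basis. Let $$\beta=\beta(p,q)=\max\Big\{\frac{p'}{q'},\frac{q'}{p'}\Big\}.$$ Let $\tau\in(0,1]$. Then there exist $c=c(p,q,\tau)>0$ and a constant $C>0$ such that the Weak Chebyshev Greedy Algorithm with weakness parameter $\tau$ satisfies, with $\phi(N)=\lfloor c\,N^\beta\rfloor$, $$\|\mathbf x-\mathscr G_{\phi(N)}(\mathbf x)\|\le C\,\sigma_N(\mathbf x)\qquad\text{for all }N\ge1,\ \mathbf x\in\mathbb X.$$ Moreover, suppose that $\psi:\mathbb N\to\mathbb N$ and $C>0$ are such that $$\|\mathbf x-\mathscr G_{\psi(N)}(\mathbf x)\|\le C\,\sigma_N(\mathbf x)\qquad\text{for all }N\ge1,\ \mathbf x\in\mathbb X.$$ Then there is $c'>0$ such that $\psi(N)\ge c'\,N^\beta$ for all $N\ge1$.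
   Context: Scalars are $\mathbb K=\mathbb R$ or $\mathbb C$; $p'=p/(p-1)$, $q'=q/(q-1)$. $\ell^p(\ell^q)$ is the space of sequences $\mathbf x=(x_{j,k})_{j,k\ge1}$ in $\mathbb K$ with norm $\|\mathbf x\|=\big[\sum_{j\ge1}\big(\sum_{k\ge1}|x_{j,k}|^q\big)^{p/q}\big]^{1/p}<\infty$; the canonical basis is $\{\mathbf e_{j,k}\}_{j,k\ge1}$. For a dictionary $\mathcal D$ (unit vectors with dense span), $\Sigma_N$ is the set of linear combinations of at most $N$ elements of $\mathcal D$, $\sigma_N(f)=\inf_{a\in\Sigma_N}\|f-a\|$. For $f\neq0$, $F_f\in\mathbb X^*$ is the norming functional: $\|F_f\|_{\mathbb X^*}=1$, $F_f(f)=\|f\|$. Square brackets denote linear span. Weak Chebyshev Greedy Algorithm (WCGA) with parameter $\tau\in(0,1]$: given $f\neq0$ put $f_0=f$. At step $n+1$ choose any $\varphi_{i_{n+1}}\in\mathcal D$ with $|F_{f_n}(\varphi_{i_{n+1}})|\ge\tau\sup_{\varphi\in\mathcal D}|F_{f_n}(\varphi)|$; let $\mathscr G_{n+1}(f)$ be any element of $[\varphi_{i_1},\dots,\varphi_{i_{n+1}}]$ with $\|f-\mathscr G_{n+1}(f)\|=\mathrm{dist}(f,[\varphi_{i_1},\dots,\varphi_{i_{n+1}}])$; put $f_{n+1}=f-\mathscr G_{n+1}(f)$. Iterate indefinitely, or until the remainder is $0$ (in which case the later remainders are also taken to be $0$). Also $\mathscr G_0(f)=0$. Inequalities for $\|f-\mathscr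 G_n(f)\|$ (both in conclusions and in hypotheses) are understood to hold for every admissible run of the algorithm. *)

theory Defs
  imports "HOL-Analysis.Analysis" "HOL-Library.Function_Algebras"
begin

text \<open>
  Double sequences over a scalar field \<open>'k\<close> (real or complex) are functions \<open>nat \<Rightarrow> nat \<Rightarrow> 'k\<close>;
  both indices start at \<open>0\<close> instead of \<open>1\<close>.  Addition, subtraction and \<open>0\<close> are pointwise.
\<close>

definition dscale :: "'k::real_normed_field \<Rightarrow> (nat \<Rightarrow> nat \<Rightarrow> 'k) \<Rightarrow> nat \<Rightarrow> nat \<Rightarrow> 'k" where
  "dscale c x = (\<lambda>j k. c * x j k)"

global_interpretation dseq: vector_space dscale
  defines dspan = dseq.span
  by unfold_locales (simp_all add: dscale_def fun_eq_iff algebra_simps)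

definition lplq :: "real \<Rightarrow> real \<Rightarrow> (nat \<Rightarrow> nat \<Rightarrow> 'k::real_normed_field) set" where
  "lplq p q = {x. (\<forall>j. summable (\<lambda>k. norm (x j k) powr q)) \<and>
                  summable (\<lambda>j. (\<Sum>k. norm (x j k) powr q) powr (p / q))}"

definition lplq_norm :: "real \<Rightarrow> real \<Rightarrow> (nat \<Rightarrow> nat \<Rightarrow> 'k::real_normed_field) \<Rightarrow> real" where
  "lplq_norm p q x = (\<Sum>j. (\<Sum>k. norm (x j k) powr q) powr (p / q)) powr (1 / p)"

definition unit_seq :: "nat \<Rightarrow> nat \<Rightarrow> nat \<Rightarrow> nat \<Rightarrow> 'k::real_normed_field" where
  "unit_seq j k = (\<lambda>j' k'. if j' = j \<and> k' = k then 1 else 0)"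

definition canonical_basis :: "(nat \<Rightarrow> nat \<Rightarrow> 'k::real_normed_field) set" where
  "canonical_basis = {unit_seq j k | j k. True}"

definition sparse :: "(nat \<Rightarrow> nat \<Rightarrow> 'k::real_normed_field) set \<Rightarrow> nat \<Rightarrow> (nat \<Rightarrow> nat \<Rightarrow> 'k) set" where
  "sparse D N = (\<Union>S\<in>{S. S \<subseteq> D \<and> finite S \<and> card S \<le> N}. dspan S)"

definition lplq_dist ::
    "real \<Rightarrow> real \<Rightarrow> (nat \<Rightarrow> nat \<Rightarrow> 'k::real_normed_field) \<Rightarrow> (nat \<Rightarrow> nat \<Rightarrow> 'k) set \<Rightarrow> real" where
  "lplq_dist p q x A = (INF a\<in>A. lplq_norm p q (x - a))"

definition best_error ::
    "real \<Rightarrow> real \<Rightarrow> (nat \<Rightarrow> nat \<Rightarrow> 'k::real_normed_field) set \<Rightarrow> nat \<Rightarrow> (nat \<Rightarrow> nat \<Rightarrow> 'k) \<Rightarrow> real" where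
  "best_error p q D N x = lplq_dist p q x (sparse D N)"

text \<open>
  Functionals are functions on all double sequences, of which only the values on
  \<open>lplq p q\<close> matter.  Linearity is over the scalar field \<open>'k\<close>.
\<close>

definition lplq_dual :: "real \<Rightarrow> real \<Rightarrow> ((nat \<Rightarrow> nat \<Rightarrow> 'k::real_normed_field) \<Rightarrow> 'k) set" where
  "lplq_dual p q = {F.
     (\<forall>x\<in>lplq p q. \<forall>y\<in>lplq p q. F (x + y) = F x + F y) \<and>
     (\<forall>a. \<forall>x\<in>lplq p q. F (dscale a x) = a * F x) \<and>
     (\<exists>B. \<forall>x\<in>lplq p q. norm (F x) \<le> B * lplq_norm p q x)}"

definition lplq_dual_norm ::
    "real \<Rightarrow> real \<Rightarrow> ((nat \<Rightarrow> nat \<Rightarrow> 'k::real_normed_field) \<Rightarrow> 'k) \<Rightarrow> real" where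
  "lplq_dual_norm p q F = (SUP x\<in>{x\<in>lplq p q. lplq_norm p q x \<le> 1}. norm (F x))"

definition norming_functional ::
    "real \<Rightarrow> real \<Rightarrow> (nat \<Rightarrow> nat \<Rightarrow> 'k::real_normed_field) \<Rightarrow> ((nat \<Rightarrow> nat \<Rightarrow> 'k) \<Rightarrow> 'k) \<Rightarrow> bool" where
  "norming_functional p q f F \<longleftrightarrow>
     F \<in> lplq_dual p q \<and> lplq_dual_norm p q F = 1 \<and> F f = of_real (lplq_norm p q f)"

text \<open>
  \<open>wcga_run p q D \<tau> f \<phi> G\<close>: the approximants \<open>G 0, G 1, \<dots>\<close> of \<open>f\<close> arise from a run of the Weak
  Chebyshev Greedy Algorithm in which step \<open>n + 1\<close> selects \<open>\<phi> n\<close>.  Once the remainder \<open>f - G n\<close>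
  vanishes, \<open>G\<close> stays constant and \<open>\<phi>\<close> is irrelevant; this also covers \<open>f = 0\<close>.
\<close>

definition wcga_run ::
    "real \<Rightarrow> real \<Rightarrow> (nat \<Rightarrow> nat \<Rightarrow> 'k::real_normed_field) set \<Rightarrow> real \<Rightarrow> (nat \<Rightarrow> nat \<Rightarrow> 'k)
      \<Rightarrow> (nat \<Rightarrow> nat \<Rightarrow> nat \<Rightarrow> 'k) \<Rightarrow> (nat \<Rightarrow> nat \<Rightarrow> nat \<Rightarrow> 'k) \<Rightarrow> bool" where
  "wcga_run p q D \<tau> f \<phi> G \<longleftrightarrow> G 0 = 0 \<and>
     (\<forall>n. if f - G n = 0 then G (Suc n) = G n
          else \<phi> n \<in> D \<and>
            (\<exists>F. norming_functional p q (f - G n) F \<and>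
                 norm (F (\<phi> n)) \<ge> \<tau> * (SUP \<psi>\<in>D. norm (F \<psi>))) \<and>
            G (Suc n) \<in> dspan (\<phi> ` {..n}) \<and>
            lplq_norm p q (f - G (Suc n)) = lplq_dist p q f (dspan (\<phi> ` {..n})))"

text \<open>
  The Lebesgue-type inequality after \<open>\<theta> N\<close> iterations, for the canonical basis and every
  admissible run.  The type argument fixes the scalar field.
\<close>

definition wcga_lebesgue ::
    "'k::real_normed_field itself \<Rightarrow> real \<Rightarrow> real \<Rightarrow> real \<Rightarrow> (nat \<Rightarrow> nat) \<Rightarrow> real \<Rightarrow> bool" where
  "wcga_lebesgue K p q \<tau> \<theta> C \<longleftrightarrow>
     (\<forall>N\<ge>1. \<forall>x \<in> (lplq p q :: (nat \<Rightarrow> nat \<Rightarrow> 'k) set). \<forall>\<phi> G.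
        wcga_run p q canonical_basis \<tau> x \<phi> G \<longrightarrow>
        lplq_norm p q (x - G (\<theta> N)) \<le> C * best_error p q canonical_basis N x)"

definition conj_exp :: "real \<Rightarrow> real" where
  "conj_exp p = p / (p - 1)"

definition wcga_beta :: "real \<Rightarrow> real \<Rightarrow> real" where
  "wcga_beta p q = max (conj_exp p / conj_exp q) (conj_exp q / conj_exp p)"

end

theory Submission
  imports Defs
begin

text \<open>
  Since the norm is strictly monotone in the moduli of the entries, the best approximation from a
  coordinate subspace is the coordinate projection, so the WCGA just deletes entries.  Write
  \<open>S\<^sub>j = \<Sum>\<^sub>k |f\<^sub>j\<^sub>k|\<^sup>q\<close> and \<open>r = p/q\<close>.  Deleting the entry \<open>a = |f\<^sub>j\<^sub>k|\<close> lowers the energy \<open>\<parallel>f\<parallel>\<^sup>p = \<Sum>\<^sub>j S\<^sub>j\<^sup>r\<close>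
  by an amount comparable with the gain \<open>E = S\<^sub>j\<^sup>r\<^sup>-\<^sup>1 a\<^sup>q\<close>, and \<open>|F\<^sub>f(e\<^sub>j\<^sub>k)|\<close> is comparable with
  \<open>w = E / a\<close> for \<open>\<parallel>f\<parallel> = 1\<close>.  In terms of \<open>b = S\<^sub>j\<^sup>1\<^sup>/\<^sup>q \<le> 1\<close> and \<open>t = a/b \<le> 1\<close> we have \<open>E = b\<^sup>p t\<^sup>q\<close> and
  \<open>w = b\<^sup>p\<^sup>-\<^sup>1 t\<^sup>q\<^sup>-\<^sup>1\<close>, hence \<open>w\<^sup>P \<le> E \<le> w\<^sup>Q\<close> where \<open>P\<close>, \<open>Q\<close> are the maximum and minimum of \<open>p'\<close>, \<open>q'\<close>.

  Let \<open>A\<close> be a set of \<open>N\<close> indices with \<open>\<parallel>f - P\<^sub>A f\<parallel> = \<sigma>\<close>.  As long as the remainder exceeds \<open>2\<sigma>\<close>, some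
  index in \<open>A\<close> has \<open>E \<ge> c/N\<close> relative to the energy, so every pick has \<open>E \<ge> c N\<^sup>-\<^sup>P\<^sup>/\<^sup>Q = c N\<^sup>-\<^sup>\<beta>\<close>.  The
  picks outside \<open>A\<close> made from a remainder of norm \<open>u\<close> on have total gain at most
  \<open>C \<sigma>\<^sup>s u\<^sup>p\<^sup>-\<^sup>s\<close>, \<open>s = min p q\<close>; so there are at most \<open>C N\<^sup>\<beta> (\<sigma>/u)\<^sup>s\<close> of them until the norm is halved,
  and these bounds form a geometric series.

  For the lower bound take one row of equal entries \<open>\<alpha>\<close> (the handle) and many rows with the single
  entry \<open>1\<close> (the teeth).  If \<open>p \<le> q\<close>, \<open>N\<close> handle entries are optimal but the teeth can be picked
  first; if \<open>q \<le> p\<close>, \<open>N\<close> teeth are optimal but half of a long handle can be picked first.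
\<close>

section \<open>Powers and Hoelder's inequality\<close>

text \<open>Convexity of \<open>v powr p\<close>, read off from Young's inequality for
  \<open>u powr (p - 1)\<close> and \<open>v\<close>; the endpoint \<open>v = 0\<close> needs no
  separate treatment this way.\<close>

lemma powr_ge_tangent:
  fixes u v p :: real
  assumes "1 \<le> p" "0 < u" "0 \<le> v"
  shows "u powr p + p * u powr (p - 1) * (v - u) \<le> v powr p"
proof (cases "p = 1")
  case True
  then show ?thesis using assms by simp
next
  case False
  then have p: "1 < p" using assms by simp
  have "u powr (p - 1) * v \<le> (u powr (p - 1)) powr (p / (p - 1)) / (p / (p - 1)) + v powr p / p"
    by (rule Youngs_inequality) (use p assms in \<open>auto simp: field_simps\<close>)
  also have "(u powr (p - 1)) powr (p / (p - 1)) = u powr p"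
    using p by (simp add: powr_powr)
  finally have "p * (u powr (p - 1) * v) \<le> (p - 1) * u powr p + v powr p"
    using p by (simp add: field_simps)
  moreover have "u powr (p - 1) * u = u powr p"
    using assms by (simp add: powr_mult_base mult.commute)
  ultimately show ?thesis by (simp add: algebra_simps)
qed

text \<open>The concave case is the convex one for exponent \<open>1/r\<close> at the points
  \<open>u powr r\<close> and \<open>v powr r\<close>, multiplied by
  \<open>u powr (r - 1)\<close>.\<close>

lemma powr_le_tangent:
  fixes u v r :: real
  assumes "0 < r" "r \<le> 1" "0 < u" "0 \<le> v"
  shows "v powr r \<le> u powr r + r * u powr (r - 1) * (v - u)"
proof -
  have "(u powr r) powr (1/r) + (1/r) * (u powr r) powr (1/r - 1) * (v powr r - u powr r)
        \<le> (v powr r) powr (1/r)"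
    by (rule powr_ge_tangent) (use assms in auto)
  moreover have "(u powr r) powr (1/r - 1) = u powr (1 - r)"
    using assms by (simp add: powr_powr right_diff_distrib)
  ultimately have "u + (1/r) * u powr (1 - r) * (v powr r - u powr r) \<le> v"
    using assms by (simp add: powr_powr)
  then have "u powr (1 - r) * (v powr r - u powr r) \<le> r * (v - u)"
    using assms by (simp add: field_simps)
  then have "u powr (r - 1) * (u powr (1 - r) * (v powr r - u powr r)) \<le> u powr (r - 1) * (r * (v - u))"
    by (intro mult_left_mono) auto
  moreover have "u powr (r - 1) * u powr (1 - r) = 1"
    using assms by (simp flip: powr_add)
  ultimately show ?thesis by (simp add: algebra_simps)
qed

text \<open>Bounds from below the energy lost when \<open>y\<close> is taken out of a row sum
  \<open>S\<close>: by concavity if \<open>r \<le> 1\<close>, and by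
  \<open>(S - y) powr (r - 1) \<le> S powr (r - 1)\<close> otherwise.\<close>

lemma powr_decrement_ge:
  fixes S y r :: real
  assumes "0 < r" "0 < S" "0 \<le> y" "y \<le> S"
  shows "min 1 r * (S powr (r - 1) * y) \<le> S powr r - (S - y) powr r"
proof (cases "r \<le> 1")
  case True
  then show ?thesis using powr_le_tangent[of r S "S - y"] assms by (simp add: algebra_simps)
next
  case False
  have "(S - y) powr r = (S - y) powr (r - 1) * (S - y)"
    using assms powr_mult_base[of "S - y" "r - 1"] by (simp add: mult.commute)
  also have "\<dots> \<le> S powr (r - 1) * (S - y)"
    using assms False by (intro mult_right_mono powr_mono2) auto
  also have "\<dots> = S powr r - S powr (r - 1) * y"
    using assms powr_mult_base[of S "r - 1"] by (simp add: algebra_simps)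
  finally show ?thesis using False by simp
qed

text \<open>For \<open>r > 1\<close> the tangent inequality produces the slope at
  \<open>S + y\<close>; the bound \<open>y \<le> B * S\<close> makes this comparable with the slope
  at \<open>S\<close>.\<close>

lemma powr_increment_le:
  fixes S y r B :: real
  assumes "0 < r" "0 < S" "0 \<le> y" "y \<le> B * S"
  shows "(S + y) powr r - S powr r \<le> r * max 1 ((1 + B) powr (r - 1)) * (S powr (r - 1) * y)"
proof (cases "r \<le> 1")
  case True
  have "(S + y) powr r - S powr r \<le> r * (S powr (r - 1) * y)"
    using powr_le_tangent[of r S "S + y"] assms True by (simp add: algebra_simps)
  also have "\<dots> \<le> r * max 1 ((1 + B) powr (r - 1)) * (S powr (r - 1) * y)"
    using assms by (intro mult_right_mono) auto
  finally show ?thesis .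
next
  case False
  have B: "0 \<le> B"
    using assms by (metis dual_order.trans linorder_not_less mult_neg_pos)
  have "(S + y) powr r - S powr r \<le> r * ((S + y) powr (r - 1) * y)"
    using powr_ge_tangent[of r "S + y" S] assms False by (simp add: algebra_simps)
  also have "(S + y) powr (r - 1) \<le> ((1 + B) * S) powr (r - 1)"
    using assms False by (intro powr_mono2) (auto simp: algebra_simps)
  also have "\<dots> = (1 + B) powr (r - 1) * S powr (r - 1)"
    using assms B by (simp add: powr_mult)
  also have "\<dots> \<le> max 1 ((1 + B) powr (r - 1)) * S powr (r - 1)"
    by (intro mult_right_mono) auto
  finally show ?thesis
    using assms by (simp add: mult_left_mono mult_right_mono mult_ac)
qed

text \<open>Hoelder's inequality in the shape in which the coefficients of a norming functional
  occur. A vanishing factor is treated apart, because the proof normalises both sums to one.\<close>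

lemma Holder_sum:
  fixes f g :: "'i \<Rightarrow> real"
  assumes "finite I" "1 < p" "\<And>i. i \<in> I \<Longrightarrow> 0 \<le> f i" "\<And>i. i \<in> I \<Longrightarrow> 0 \<le> g i"
  shows "(\<Sum>i\<in>I. f i powr (p - 1) * g i)
    \<le> (\<Sum>i\<in>I. f i powr p) powr ((p - 1) / p) * (\<Sum>i\<in>I. g i powr p) powr (1 / p)"
proof -
  define A where "A = (\<Sum>i\<in>I. f i powr p)"
  define B where "B = (\<Sum>i\<in>I. g i powr p)"
  have AB: "0 \<le> A" "0 \<le> B" unfolding A_def B_def by (auto intro: sum_nonneg)
  consider "A = 0" | "B = 0" | "0 < A" "0 < B" using AB by linarith
  then show ?thesis
  proof cases
    case 1
    then have "\<forall>i\<in>I. f i = 0"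
      using assms(1) by (simp add: A_def sum_nonneg_eq_0_iff)
    then show ?thesis by (simp add: sum.neutral)
  next
    case 2
    then have "\<forall>i\<in>I. g i = 0"
      using assms(1) by (simp add: B_def sum_nonneg_eq_0_iff)
    then show ?thesis by (simp add: sum.neutral)
  next
    case 3
    define a where "a = A powr (1 / p)"
    define b where "b = B powr (1 / p)"
    have ab: "0 < a" "0 < b" "a powr p = A" "b powr p = B"
      using 3 assms by (simp_all add: a_def b_def powr_powr)
    have "(f i / a) powr (p - 1) * (g i / b) \<le> f i powr p / A * ((p - 1) / p) + g i powr p / B * (1 / p)"
      if "i \<in> I" for i
    proof -
      have "(f i / a) powr (p - 1) * (g i / b) \<le>
        ((f i / a) powr (p - 1)) powr (p / (p - 1)) / (p / (p - 1)) + (g i / b) powr p / p"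
        by (rule Youngs_inequality) (use assms that ab in \<open>auto simp: field_simps\<close>)
      also have "((f i / a) powr (p - 1)) powr (p / (p - 1)) = f i powr p / A"
        using assms ab that by (simp add: powr_powr powr_divide)
      also have "(g i / b) powr p = g i powr p / B"
        using assms ab that by (simp add: powr_divide)
      finally show ?thesis by (simp add: mult.commute)
    qed
    then have "(\<Sum>i\<in>I. (f i / a) powr (p - 1) * (g i / b))
       \<le> (\<Sum>i\<in>I. f i powr p / A * ((p - 1) / p) + g i powr p / B * (1 / p))"
      by (rule sum_mono)
    also have "\<dots> = (\<Sum>i\<in>I. f i powr p) / A * ((p - 1) / p) + (\<Sum>i\<in>I. g i powr p) / B * (1 / p)"
      by (simp add: sum.distrib sum_distrib_right sum_divide_distrib)
    also have "\<dots> = 1"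
      using 3 assms unfolding A_def[symmetric] B_def[symmetric] by (simp add: field_simps)
    finally have "(\<Sum>i\<in>I. (f i / a) powr (p - 1) * (g i / b)) \<le> 1" .
    moreover have "(\<Sum>i\<in>I. (f i / a) powr (p - 1) * (g i / b))
       = (\<Sum>i\<in>I. f i powr (p - 1) * g i) / (a powr (p - 1) * b)"
      unfolding sum_divide_distrib
      by (rule sum.cong) (use assms ab in \<open>auto simp: powr_divide\<close>)
    ultimately have "(\<Sum>i\<in>I. f i powr (p - 1) * g i) / (a powr (p - 1) * b) \<le> 1"
      by simp
    then have "(\<Sum>i\<in>I. f i powr (p - 1) * g i) \<le> a powr (p - 1) * b"
      using ab by (subst (asm) pos_divide_le_eq) auto
    also have "a powr (p - 1) = A powr ((p - 1) / p)"
      by (simp add: a_def powr_powr)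
    finally show ?thesis by (simp add: b_def A_def B_def)
  qed
qed

section \<open>The spaces \<open>\<ell>\<^sup>p(\<ell>\<^sup>q)\<close>\<close>

text \<open>Powers of the row norm and, with \<open>energy\<close>, of the full norm: in these
  quantities a change of one entry alters a single summand, so it can be computed exactly.\<close>

definition row_energy :: "real \<Rightarrow> (nat \<Rightarrow> nat \<Rightarrow> 'k::real_normed_field) \<Rightarrow> nat \<Rightarrow> real" where
  "row_energy q x j = (\<Sum>k. norm (x j k) powr q)"

definition energy :: "real \<Rightarrow> real \<Rightarrow> (nat \<Rightarrow> nat \<Rightarrow> 'k::real_normed_field) \<Rightarrow> real" where
  "energy p q x = (\<Sum>j. row_energy q x j powr (p / q))"

text \<open>One operation covers deleting an entry, perturbing an entry, and building a unit
  sequence from \<open>0\<close>.\<close>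

definition upd :: "(nat \<Rightarrow> nat \<Rightarrow> 'k) \<Rightarrow> nat \<Rightarrow> nat \<Rightarrow> 'k \<Rightarrow> nat \<Rightarrow> nat \<Rightarrow> 'k" where
  "upd x j k v = (\<lambda>j' k'. if j' = j \<and> k' = k then v else x j' k')"

definition delete :: "(nat \<times> nat) set \<Rightarrow> (nat \<Rightarrow> nat \<Rightarrow> 'k::zero) \<Rightarrow> nat \<Rightarrow> nat \<Rightarrow> 'k" where
  "delete \<Gamma> x = (\<lambda>j k. if (j, k) \<in> \<Gamma> then 0 else x j k)"

abbreviation unit_vec :: "nat \<times> nat \<Rightarrow> nat \<Rightarrow> nat \<Rightarrow> 'k::real_normed_field" where
  "unit_vec e \<equiv> unit_seq (fst e) (snd e)"

lemma lplq_iff: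
  "x \<in> lplq p q \<longleftrightarrow> (\<forall>j. summable (\<lambda>k. norm (x j k) powr q)) \<and>
    summable (\<lambda>j. row_energy q x j powr (p / q))"
  by (simp add: lplq_def row_energy_def)

lemma lplq_norm_eq: "lplq_norm p q x = energy p q x powr (1 / p)"
  by (simp add: lplq_norm_def energy_def row_energy_def)

lemma lplq_norm_nonneg: "0 \<le> lplq_norm p q x"
  by (simp add: lplq_norm_eq)

lemma delete_empty [simp]: "delete {} x = x"
  by (simp add: delete_def)

lemma delete_insert: "delete (insert (j, k) \<Gamma>) x = upd (delete \<Gamma> x) j k 0"
  by (auto simp: delete_def upd_def fun_eq_iff)

lemma delete_delete: "delete \<Gamma> (delete \<Delta> x) = delete (\<Gamma> \<union> \<Delta>) x"
  by (auto simp: delete_def fun_eq_iff)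

lemma upd_eq_add: "upd x j k v = x + dscale (v - x j k) (unit_seq j k)"
  by (auto simp: upd_def dscale_def unit_seq_def fun_eq_iff)

lemma minus_delete_in_span:
  assumes "finite \<Gamma>"
  shows "x - delete \<Gamma> x \<in> dspan (unit_vec ` \<Gamma>)"
  using assms
proof induction
  case empty
  have "x - delete {} x = 0" by (simp add: fun_eq_iff)
  then show ?case by (metis dseq.span_zero)
next
  case (insert e \<Gamma>)
  obtain j k where e: "e = (j, k)" by (cases e)
  have eq: "x - delete (insert e \<Gamma>) x = (x - delete \<Gamma> x) + dscale (delete \<Gamma> x j k) (unit_seq j k)"
    by (simp add: e delete_insert upd_eq_add fun_eq_iff dscale_def)
  have "x - delete \<Gamma> x \<in> dspan (unit_vec ` insert e \<Gamma>)"
    using insert.IH dseq.span_mono[of "unit_vec ` \<Gamma>" "unit_vec ` insert e \<Gamma>"]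
    by blast
  moreover have "dscale (delete \<Gamma> x j k) (unit_seq j k) \<in> dspan (unit_vec ` insert e \<Gamma>)"
    by (intro dseq.span_scale dseq.span_base) (auto simp: e)
  ultimately show ?case unfolding eq by (rule dseq.span_add)
qed

lemma span_unit_vec_supported:
  assumes "a \<in> dspan (unit_vec ` \<Gamma>)" "(j, k) \<notin> \<Gamma>"
  shows "a j k = (0::'k::real_normed_field)"
proof -
  have "dseq.subspace {y::nat \<Rightarrow> nat \<Rightarrow> 'k. y j k = 0}"
    by (auto simp: dseq.subspace_def dscale_def)
  moreover have "unit_vec ` \<Gamma> \<subseteq> {y::nat \<Rightarrow> nat \<Rightarrow> 'k. y j k = 0}"
    using assms(2) by (auto simp: unit_seq_def)
  ultimately show ?thesis using assms(1) dseq.span_minimal by blast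
qed

locale mixed_exponents =
  fixes p q :: real
  assumes p: "1 < p" and q: "1 < q"
begin

abbreviation "r \<equiv> p / q"

lemma r_pos: "0 < r"
  using p q by simp

lemma row_summable: "x \<in> lplq p q \<Longrightarrow> summable (\<lambda>k. norm (x j k) powr q)"
  by (simp add: lplq_iff)

lemma energy_summable: "x \<in> lplq p q \<Longrightarrow> summable (\<lambda>j. row_energy q x j powr r)"
  by (simp add: lplq_iff)

lemma row_energy_nonneg: "x \<in> lplq p q \<Longrightarrow> 0 \<le> row_energy q x j"
  unfolding row_energy_def by (intro suminf_nonneg row_summable) auto

lemma entry_le_row_energy: "x \<in> lplq p q \<Longrightarrow> norm (x j k) powr q \<le> row_energy q x j"
  using sum_le_suminf[OF row_summable, of x "{k}" j] by (simp add: row_energy_def)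

lemma row_le_energy: "x \<in> lplq p q \<Longrightarrow> row_energy q x j powr r \<le> energy p q x"
  using sum_le_suminf[OF energy_summable, of x "{j}"] by (simp add: energy_def)

lemma energy_nonneg: "x \<in> lplq p q \<Longrightarrow> 0 \<le> energy p q x"
  by (meson order_trans powr_ge_zero row_le_energy)

lemma energy_eq_norm_powr: "x \<in> lplq p q \<Longrightarrow> energy p q x = lplq_norm p q x powr p"
  using p energy_nonneg[of x] by (simp add: lplq_norm_eq powr_powr)

lemma lplq_zero: "0 \<in> lplq p q"
  using p q by (simp add: lplq_iff row_energy_def)

lemma lplq_norm_zero: "lplq_norm p q 0 = 0"
  using p q by (simp add: lplq_norm_eq energy_def row_energy_def)

lemma lplq_norm_pos: "x \<in> lplq p q \<Longrightarrow> x \<noteq> 0 \<Longrightarrow> 0 < lplq_norm p q x"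
proof -
  assume x: "x \<in> lplq p q" "x \<noteq> 0"
  then obtain j k where "x j k \<noteq> 0" by (auto simp: fun_eq_iff)
  then have "0 < norm (x j k) powr q" by simp
  also have "\<dots> \<le> row_energy q x j" using x entry_le_row_energy by blast
  finally have "0 < row_energy q x j powr r" by simp
  also have "\<dots> \<le> energy p q x" using x row_le_energy by blast
  finally show ?thesis by (simp add: lplq_norm_eq)
qed

section \<open>Monotonicity of the norm in the moduli of the entries\<close>

context
  fixes x y :: "nat \<Rightarrow> nat \<Rightarrow> 'k::real_normed_field"
  assumes x: "x \<in> lplq p q" and le: "\<And>j k. norm (y j k) \<le> norm (x j k)"
begin

lemma row_summable_mono: "summable (\<lambda>k. norm (y j k) powr q)"
  by (rule summable_comparison_test'[OF row_summable[OF x, of j], of 0])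
    (use q le in \<open>auto intro: powr_mono2\<close>)

lemma row_energy_mono: "row_energy q y j \<le> row_energy q x j"
  unfolding row_energy_def
  by (intro suminf_le row_summable_mono row_summable[OF x] powr_mono2) (use q le in auto)

lemma row_energy_powr_mono: "row_energy q y j powr r \<le> row_energy q x j powr r"
proof (rule powr_mono2[OF _ _ row_energy_mono])
  show "0 \<le> row_energy q y j"
    unfolding row_energy_def by (intro suminf_nonneg row_summable_mono) auto
qed (use r_pos in simp)

lemma lplq_mono: "y \<in> lplq p q"
  unfolding lplq_iff
proof (intro conjI allI row_summable_mono)
  show "summable (\<lambda>j. row_energy q y j powr r)"
    by (rule summable_comparison_test'[OF energy_summable[OF x], of 0])
      (use row_energy_powr_mono in auto)
qed

lemma energy_mono: "energy p q y \<le> energy p q x"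
  unfolding energy_def
  by (intro suminf_le row_energy_powr_mono energy_summable x lplq_mono)

lemma lplq_norm_mono: "lplq_norm p q y \<le> lplq_norm p q x"
  unfolding lplq_norm_eq
  using energy_mono energy_nonneg[OF lplq_mono] p by (intro powr_mono2) auto

end

lemma delete_lplq: "x \<in> lplq p q \<Longrightarrow> delete \<Gamma> x \<in> lplq p q"
  by (rule lplq_mono) (auto simp: delete_def)

lemma row_energy_delete_antimono:
  "x \<in> lplq p q \<Longrightarrow> \<Delta> \<subseteq> \<Gamma> \<Longrightarrow> row_energy q (delete \<Gamma> x) j \<le> row_energy q (delete \<Delta> x) j"
  by (rule row_energy_mono, erule delete_lplq) (auto simp: delete_def)

lemma norm_delete_antimono:
  "x \<in> lplq p q \<Longrightarrow> \<Delta> \<subseteq> \<Gamma> \<Longrightarrow> lplq_norm p q (delete \<Gamma> x) \<le> lplq_norm p q (delete \<Delta> x)"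
  by (rule lplq_norm_mono, erule delete_lplq) (auto simp: delete_def)

section \<open>Changing a single entry\<close>

context
  fixes x :: "nat \<Rightarrow> nat \<Rightarrow> 'k::real_normed_field"
  assumes x: "x \<in> lplq p q"
begin

text \<open>A series with one nonzero term is added to the row. The \<open>sums\<close> form, here
  and in \<open>energy_sums_upd\<close>, delivers both membership of the changed sequence and the
  value of its energy.\<close>

lemma row_sums_upd:
  "(\<lambda>k'. norm (upd x j k v j k') powr q) sums (row_energy q x j - norm (x j k) powr q + norm v powr q)"
proof -
  have "(\<lambda>k'. norm (x j k') powr q + (if k' = k then norm v powr q - norm (x j k) powr q else 0)) sums
     (row_energy q x j + (norm v powr q - norm (x j k) powr q))"
    unfolding row_energy_def
    by (intro sums_add summable_sums row_summable x sums_single)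
  moreover have "(\<lambda>k'. norm (x j k') powr q + (if k' = k then norm v powr q - norm (x j k) powr q else 0))
    = (\<lambda>k'. norm (upd x j k v j k') powr q)"
    by (auto simp: upd_def)
  ultimately show ?thesis by (simp add: algebra_simps)
qed

lemma row_energy_upd:
  "row_energy q (upd x j k v) j = row_energy q x j - norm (x j k) powr q + norm v powr q"
  using row_sums_upd unfolding row_energy_def by (simp add: sums_iff)

lemma row_energy_upd_other: "j' \<noteq> j \<Longrightarrow> row_energy q (upd x j k v) j' = row_energy q x j'"
  by (simp add: row_energy_def upd_def)

lemma energy_sums_upd:
  "(\<lambda>j'. row_energy q (upd x j k v) j' powr r) sums
    (energy p q x - row_energy q x j powr r + (row_energy q x j - norm (x j k) powr q + norm v powr q) powr r)"
proof -
  let ?d = "(row_energy q x j - norm (x j k) powr q + norm v powr q) powr r - row_energy q x j powr r"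
  have "(\<lambda>j'. row_energy q x j' powr r + (if j' = j then ?d else 0)) sums (energy p q x + ?d)"
    unfolding energy_def
    by (intro sums_add summable_sums energy_summable x sums_single)
  moreover have "(\<lambda>j'. row_energy q x j' powr r + (if j' = j then ?d else 0))
    = (\<lambda>j'. row_energy q (upd x j k v) j' powr r)"
    by (auto simp: row_energy_upd row_energy_upd_other fun_eq_iff)
  ultimately show ?thesis by (simp add: algebra_simps)
qed

lemma upd_lplq: "upd x j k v \<in> lplq p q"
  unfolding lplq_iff
proof (intro conjI allI)
  show "summable (\<lambda>k'. norm (upd x j k v j' k') powr q)" for j'
  proof (cases "j' = j")
    case True
    then show ?thesis using row_sums_upd sums_summable by blast
  next
    case False
    then show ?thesis using row_summable[OF x] by (simp add: upd_def)
  qed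
  show "summable (\<lambda>j'. row_energy q (upd x j k v) j' powr r)"
    using energy_sums_upd sums_summable by blast
qed

lemma energy_upd:
  "energy p q (upd x j k v) = energy p q x - row_energy q x j powr r
     + (row_energy q x j - norm (x j k) powr q + norm v powr q) powr r"
  using energy_sums_upd unfolding energy_def[of p q "upd x j k v"] by (simp add: sums_iff)

end

lemma unit_seq_eq_upd: "unit_seq j k = upd 0 j k 1"
  by (auto simp: unit_seq_def upd_def fun_eq_iff)

lemma unit_seq_lplq: "unit_seq j k \<in> lplq p q"
  unfolding unit_seq_eq_upd by (intro upd_lplq lplq_zero)

lemma energy_zero: "energy p q 0 = 0"
  using p q by (simp add: energy_def row_energy_def)

lemma norm_unit_seq: "lplq_norm p q (unit_seq j k :: nat \<Rightarrow> nat \<Rightarrow> 'k::real_normed_field) = 1"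
proof -
  have "row_energy q (0 :: nat \<Rightarrow> nat \<Rightarrow> 'k) j = 0" by (simp add: row_energy_def)
  then show ?thesis
    by (simp add: unit_seq_eq_upd lplq_norm_eq energy_upd[OF lplq_zero] energy_zero)
qed

lemma dscale_lplq_norm:
  fixes x :: "nat \<Rightarrow> nat \<Rightarrow> 'k::real_normed_field"
  assumes x: "x \<in> lplq p q"
  shows "dscale c x \<in> lplq p q" "lplq_norm p q (dscale c x) = norm c * lplq_norm p q x"
proof -
  have row: "(\<lambda>k. norm (dscale c x j k) powr q) sums (norm c powr q * row_energy q x j)" for j
  proof -
    have "(\<lambda>k. norm c powr q * norm (x j k) powr q) sums (norm c powr q * row_energy q x j)"
      unfolding row_energy_def by (intro sums_mult summable_sums row_summable x)
    then show ?thesis by (simp add: dscale_def norm_mult powr_mult)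
  qed
  then have row': "row_energy q (dscale c x) j = norm c powr q * row_energy q x j" for j
    unfolding row_energy_def by (simp add: sums_iff)
  have "(\<lambda>j. norm c powr p * row_energy q x j powr r) sums (norm c powr p * energy p q x)"
    unfolding energy_def by (intro sums_mult summable_sums energy_summable x)
  moreover have "norm c powr p * row_energy q x j powr r = row_energy q (dscale c x) j powr r" for j
    using row_energy_nonneg[OF x] q by (simp add: row' powr_mult powr_powr)
  ultimately have e: "(\<lambda>j. row_energy q (dscale c x) j powr r) sums (norm c powr p * energy p q x)"
    by simp
  show "dscale c x \<in> lplq p q"
    unfolding lplq_iff using row e sums_summable by blast
  have "energy p q (dscale c x) = norm c powr p * energy p q x"
    using e unfolding energy_def by (simp add: sums_iff)
  then show "lplq_norm p q (dscale c x) = norm c * lplq_norm p q x"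
    using energy_nonneg[OF x] p by (simp add: lplq_norm_eq powr_mult powr_powr)
qed

text \<open>Strictness comes from \<open>p\<close> and \<open>q\<close> being finite: one row sum
  drops strictly and the others stay. It is the source of the uniqueness of best
  approximations.\<close>

lemma delete_strict:
  fixes x :: "nat \<Rightarrow> nat \<Rightarrow> 'k::real_normed_field"
  assumes x: "x \<in> lplq p q" and "x j k \<noteq> 0"
  shows "lplq_norm p q (upd x j k 0) < lplq_norm p q x"
proof -
  have "0 < norm (x j k) powr q" using assms by simp
  moreover have "norm (x j k) powr q \<le> row_energy q x j" using entry_le_row_energy[OF x] .
  ultimately have "energy p q (upd x j k 0) < energy p q x"
    using r_pos q by (simp add: energy_upd[OF x] powr_less_mono2)
  then show ?thesis
    using energy_nonneg[OF upd_lplq[OF x]] p unfolding lplq_norm_eq by (intro powr_less_mono2) auto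
qed

end

section \<open>Norming functionals\<close>

definition gain :: "real \<Rightarrow> real \<Rightarrow> (nat \<Rightarrow> nat \<Rightarrow> 'k::real_normed_field) \<Rightarrow> nat \<Rightarrow> nat \<Rightarrow> real" where
  "gain p q x j k = row_energy q x j powr (p / q - 1) * norm (x j k) powr q"

text \<open>Let \<open>t\<close> tend to \<open>0\<close> from the right. This will show that a
  linear term dominated by a higher power of \<open>t\<close> has coefficient zero.\<close>

lemma nonpos_if_le_small_powr:
  fixes c B s d :: real
  assumes "0 < s" "0 < d" and le: "\<And>t. 0 < t \<Longrightarrow> t \<le> d \<Longrightarrow> c \<le> B * t powr s"
  shows "c \<le> 0"
proof (rule tendsto_lowerbound)
  have "((\<lambda>t. B * t powr s) \<longlongrightarrow> B * 0) (at_right 0)"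
    by (intro tendsto_mult tendsto_const tendsto_zero_powrI[where b = s])
      (use assms in \<open>auto intro!: eventually_at_rightI[of 0 1]\<close>)
  then show "((\<lambda>t. B * t powr s) \<longlongrightarrow> 0) (at_right 0)" by simp
  show "\<forall>\<^sub>F t in at_right 0. c \<le> B * t powr s"
    using assms by (auto intro!: eventually_at_rightI[of 0 d])
qed simp

context mixed_exponents
begin

lemma gain_nonneg: "0 \<le> gain p q x j k"
  by (simp add: gain_def)

text \<open>The dual norm is a real supremum, so it bounds its members only once the set is known to
  be bounded; membership in the dual supplies this, and rescaling \<open>y\<close> to norm one does
  the rest.\<close>

lemma norming_functional_bound:
  fixes f y :: "nat \<Rightarrow> nat \<Rightarrow> 'k::real_normed_field"
  assumes F: "norming_functional p q f F" and y: "y \<in> lplq p q"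
  shows "norm (F y) \<le> lplq_norm p q y"
proof -
  obtain B where B: "\<And>x :: nat \<Rightarrow> nat \<Rightarrow> 'k. x \<in> lplq p q \<Longrightarrow> norm (F x) \<le> B * lplq_norm p q x"
    and scale: "\<And>a (x :: nat \<Rightarrow> nat \<Rightarrow> 'k). x \<in> lplq p q \<Longrightarrow> F (dscale a x) = a * F x"
    using F unfolding norming_functional_def lplq_dual_def by blast
  have bdd: "bdd_above ((\<lambda>x. norm (F x)) ` {x :: nat \<Rightarrow> nat \<Rightarrow> 'k. x \<in> lplq p q \<and> lplq_norm p q x \<le> 1})"
  proof (rule bdd_aboveI2)
    fix x :: "nat \<Rightarrow> nat \<Rightarrow> 'k" assume x: "x \<in> {x. x \<in> lplq p q \<and> lplq_norm p q x \<le> 1}"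
    then have "norm (F x) \<le> B * lplq_norm p q x" using B by simp
    also have "\<dots> \<le> \<bar>B\<bar> * 1"
      using x lplq_norm_nonneg by (intro mult_mono) auto
    finally show "norm (F x) \<le> \<bar>B\<bar>" by simp
  qed
  show ?thesis
  proof (cases "lplq_norm p q y = 0")
    case True
    then show ?thesis using B[OF y] by simp
  next
    case False
    then have pos: "0 < lplq_norm p q y" using lplq_norm_nonneg[of p q y] by linarith
    let ?c = "of_real (1 / lplq_norm p q y)"
    have "norm (F (dscale ?c y)) \<le> lplq_dual_norm p q F"
      unfolding lplq_dual_norm_def
      using dscale_lplq_norm[OF y, of ?c] pos
      by (intro cSUP_upper[OF _ bdd]) (simp add: norm_divide)
    also have "\<dots> = 1" using F by (simp add: norming_functional_def)
    finally show ?thesis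
      using pos by (simp add: scale[OF y] norm_mult norm_divide)
  qed
qed

lemma norming_functional_upd:
  assumes F: "norming_functional p q f F" and y: "y \<in> lplq p q"
  shows "F (upd y j k v) = F y + (v - y j k) * F (unit_seq j k)"
proof -
  have "F (upd y j k v) = F y + F (dscale (v - y j k) (unit_seq j k))"
    using F y dscale_lplq_norm(1)[OF unit_seq_lplq]
    unfolding upd_eq_add norming_functional_def lplq_dual_def by blast
  moreover have "F (dscale (v - y j k) (unit_seq j k)) = (v - y j k) * F (unit_seq j k)"
    using F unit_seq_lplq unfolding norming_functional_def lplq_dual_def by blast
  ultimately show ?thesis by simp
qed

text \<open>The entries indexed by \<open>A\<close> are peeled off one at a time by
  linearity.\<close>

lemma norming_functional_support:
  assumes F: "norming_functional p q f F" and y: "y \<in> lplq p q" and A: "finite A"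
  shows "norm (F y) \<le> (\<Sum>(j, k)\<in>A. norm (F (unit_seq j k)) * norm (y j k)) + norm (F (delete A y))"
  using A
proof induction
  case empty
  then show ?case by simp
next
  case (insert e A)
  obtain j k where e: "e = (j, k)" by (cases e)
  have "F (delete (insert e A) y) = F (delete A y) - y j k * F (unit_seq j k)"
    using insert.hyps e
    by (simp add: delete_insert norming_functional_upd[OF F delete_lplq[OF y]])
      (simp add: delete_def)
  then have "F (delete A y) = F (delete (insert e A) y) + y j k * F (unit_seq j k)" by simp
  then have "norm (F (delete A y)) \<le> norm (F (delete (insert e A) y)) + norm (F (unit_seq j k)) * norm (y j k)"
    by (metis mult.commute norm_mult norm_triangle_ineq)
  then show ?case using insert by (simp add: e)
qed

text \<open>Constants of the two-sided comparison of \<open>F\<close> with the gain. The upper one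
  comes from doubling an entry, which raises its row sum by \<open>2 powr q - 1\<close> times the
  entry's share; the lower one, \<open>gain_lb\<close>, comes from deleting an entry.\<close>

definition gain_ub :: real where
  "gain_ub = r * max 1 ((1 + (2 powr q - 1)) powr (r - 1)) * (2 powr q - 1) / p"

definition gain_lb :: real where
  "gain_lb = min 1 r / p"

lemma two_powr_q: "1 < 2 powr q"
  using powr_less_mono[of 0 q 2] q by simp

lemma gain_ub_pos: "0 < gain_ub"
  using p q r_pos two_powr_q by (auto simp: gain_ub_def)

lemma gain_lb_pos: "0 < gain_lb"
  using p r_pos by (auto simp: gain_lb_def)

context
  fixes f :: "nat \<Rightarrow> nat \<Rightarrow> 'k::real_normed_field" and F
  assumes f: "f \<in> lplq p q" "f \<noteq> 0" and F: "norming_functional p q f F"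
begin

text \<open>\<open>F\<close> is tested on \<open>f\<close> with one entry moved by a scalar of
  modulus \<open>t\<close>. The norm of the result is at least \<open>F\<close>'s value there;
  convexity of the \<open>p\<close>-th power then isolates the term linear in
  \<open>t\<close>.\<close>

lemma norming_functional_perturb:
  assumes "0 \<le> t"
  shows "p * lplq_norm p q f powr (p - 1) * (t * norm (F (unit_seq j k)))
    \<le> (row_energy q f j - norm (f j k) powr q + (norm (f j k) + t) powr q) powr r - row_energy q f j powr r"
proof -
  let ?u = "lplq_norm p q f" and ?d = "norm (F (unit_seq j k))"
  have u: "0 < ?u" using f lplq_norm_pos by blast
  \<comment> \<open>A unimodular scalar that turns the contribution of the moved entry into the
    nonnegative real \<open>t * ?d\<close>.\<close>
  define s where "s = (if F (unit_seq j k) = 0 then 1 else of_real ?d / F (unit_seq j k))"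
  have s: "norm s = 1" "s * F (unit_seq j k) = of_real ?d"
    by (auto simp: s_def norm_divide)
  define v where "v = f j k + of_real t * s"
  have "norm v \<le> norm (f j k) + norm (of_real t * s)" unfolding v_def by (rule norm_triangle_ineq)
  then have v: "norm v \<le> norm (f j k) + t" using assms s by (simp add: norm_mult)
  have "F (upd f j k v) = of_real (?u + t * ?d)"
    using F s by (simp add: norming_functional_upd[OF F f(1)] v_def mult.assoc norming_functional_def)
  then have "?u + t * ?d = norm (F (upd f j k v))"
    using u assms by (simp only: norm_of_real) simp
  also have "\<dots> \<le> lplq_norm p q (upd f j k v)"
    using norming_functional_bound[OF F] upd_lplq[OF f(1)] by blast
  finally have "(?u + t * ?d) powr p \<le> lplq_norm p q (upd f j k v) powr p"
    using u assms p by (intro powr_mono2) auto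
  also have "\<dots> = energy p q f - row_energy q f j powr r
     + (row_energy q f j - norm (f j k) powr q + norm v powr q) powr r"
    using energy_eq_norm_powr[OF upd_lplq[OF f(1)]] energy_upd[OF f(1)] by metis
  also have "\<dots> \<le> energy p q f - row_energy q f j powr r
     + (row_energy q f j - norm (f j k) powr q + (norm (f j k) + t) powr q) powr r"
    using v r_pos q entry_le_row_energy[OF f(1), of j k]
    by (intro add_left_mono powr_mono2) (auto intro!: powr_mono2)
  finally have "(?u + t * ?d) powr p - energy p q f \<le>
     (row_energy q f j - norm (f j k) powr q + (norm (f j k) + t) powr q) powr r - row_energy q f j powr r"
    by simp
  moreover have "?u powr p + p * ?u powr (p - 1) * ((?u + t * ?d) - ?u) \<le> (?u + t * ?d) powr p"
    using u p assms by (intro powr_ge_tangent) auto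
  ultimately show ?thesis
    using energy_eq_norm_powr[OF f(1)] by simp
qed

text \<open>The perturbation estimate with \<open>t = norm (f j k)\<close>: the entry is doubled,
  and the energy increases by at most a multiple of the gain.\<close>

lemma norming_functional_le_gain:
  "lplq_norm p q f powr (p - 1) * (norm (F (unit_seq j k)) * norm (f j k)) \<le> gain_ub * gain p q f j k"
proof (cases "f j k = 0")
  case True
  then show ?thesis by (simp add: gain_def)
next
  case False
  let ?S = "row_energy q f j" and ?a = "norm (f j k)"
  have a: "0 < ?a powr q" "?a powr q \<le> ?S" using False entry_le_row_energy[OF f(1)] by auto
  then have S: "0 < ?S" by linarith
  have two: "1 < 2 powr q" by (rule two_powr_q)
  have "p * lplq_norm p q f powr (p - 1) * (?a * norm (F (unit_seq j k)))
    \<le> (?S - ?a powr q + (?a + ?a) powr q) powr r - ?S powr r"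
    by (rule norming_functional_perturb) simp
  also have "?a + ?a = 2 * ?a" by simp
  also have "?S - ?a powr q + (2 * ?a) powr q = ?S + (2 powr q - 1) * ?a powr q"
    by (simp add: powr_mult algebra_simps)
  also have "(?S + (2 powr q - 1) * ?a powr q) powr r - ?S powr r
     \<le> r * max 1 ((1 + (2 powr q - 1)) powr (r - 1)) * (?S powr (r - 1) * ((2 powr q - 1) * ?a powr q))"
    using a S two r_pos by (intro powr_increment_le mult_left_mono) auto
  also have "\<dots> = p * (gain_ub * gain p q f j k)"
    using p by (simp add: gain_ub_def gain_def)
  finally show ?thesis using p by (simp add: mult_ac)
qed

text \<open>Perturbing a zero entry by \<open>t\<close> raises the energy by at most
  \<open>t powr p\<close> in an empty row and by \<open>O(t powr q)\<close> in any other. As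
  \<open>p\<close> and \<open>q\<close> exceed \<open>1\<close>, the linear term cannot survive
  \<open>t \<rightarrow> 0\<close>.\<close>

lemma norming_functional_eq_0:
  assumes "f j k = 0"
  shows "F (unit_seq j k) = 0"
proof -
  let ?S = "row_energy q f j" and ?d = "norm (F (unit_seq j k))"
  let ?c = "p * lplq_norm p q f powr (p - 1)"
  have u: "0 < lplq_norm p q f" using f lplq_norm_pos by blast
  have pert: "?c * (t * ?d) \<le> (?S + t powr q) powr r - ?S powr r" if "0 < t" for t
    using norming_functional_perturb[of t j k] assms that q by simp
  have "?c * ?d \<le> 0"
  proof (cases "?S = 0")
    case True
    show ?thesis
    proof (rule nonpos_if_le_small_powr[of "p - 1" 1 _ 1])
      fix t :: real assume t: "0 < t"
      have "?c * (t * ?d) \<le> t powr p"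
        using pert[OF t] True p q t by (simp add: powr_powr)
      also have "t powr p = t * t powr (p - 1)" using t by (simp add: powr_mult_base)
      finally show "?c * ?d \<le> 1 * t powr (p - 1)" using t by simp
    qed (use p in auto)
  next
    case False
    then have S: "0 < ?S" using row_energy_nonneg[OF f(1), of j] by linarith
    let ?B = "r * max 1 ((1 + 1) powr (r - 1)) * ?S powr (r - 1)"
    show ?thesis
    proof (rule nonpos_if_le_small_powr[of "q - 1" "?S powr (1 / q)" _ ?B])
      fix t :: real assume t: "0 < t" "t \<le> ?S powr (1 / q)"
      have "t powr q \<le> (?S powr (1 / q)) powr q" using t q by (intro powr_mono2) auto
      then have "t powr q \<le> 1 * ?S" using S q by (simp add: powr_powr)
      then have "?c * (t * ?d) \<le> ?B * t powr q"
        using pert[OF t(1)] powr_increment_le[of r ?S "t powr q" 1] r_pos S by simp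
      also have "t powr q = t * t powr (q - 1)" using t by (simp add: powr_mult_base)
      finally have "t * (?c * ?d) \<le> t * (?B * t powr (q - 1))" by (simp only: mult_ac)
      then show "?c * ?d \<le> ?B * t powr (q - 1)" using t by (simp only: mult_le_cancel_left_pos)
    qed (use q S in auto)
  qed
  then show ?thesis using u p by (simp add: mult_le_0_iff)
qed

text \<open>\<open>F\<close> is tested on \<open>f\<close> without the entry: the drop of the norm
  is at most \<open>?d * ?a\<close>, while the drop of the energy is at least a multiple of the
  gain.\<close>

lemma norming_functional_ge_gain:
  "gain_lb * gain p q f j k \<le> lplq_norm p q f powr (p - 1) * (norm (F (unit_seq j k)) * norm (f j k))"
proof (cases "f j k = 0")
  case True
  then show ?thesis by (simp add: gain_def)
next
  case False
  let ?S = "row_energy q f j" and ?a = "norm (f j k)" and ?d = "norm (F (unit_seq j k))"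
  let ?u = "lplq_norm p q f" and ?v = "lplq_norm p q (upd f j k 0)"
  have u: "0 < ?u" using f lplq_norm_pos by blast
  have a: "0 < ?a powr q" "?a powr q \<le> ?S" using False entry_le_row_energy[OF f(1)] by auto
  then have S: "0 < ?S" by linarith
  have "F (upd f j k 0) = of_real ?u - f j k * F (unit_seq j k)"
    using F by (simp add: norming_functional_upd[OF F f(1)] norming_functional_def)
  then have "?u \<le> norm (F (upd f j k 0)) + norm (f j k * F (unit_seq j k))"
    using norm_triangle_ineq[of "F (upd f j k 0)" "f j k * F (unit_seq j k)"] u by simp
  also have "norm (F (upd f j k 0)) \<le> ?v"
    using norming_functional_bound[OF F] upd_lplq[OF f(1)] by blast
  finally have uv: "?u - ?v \<le> ?d * ?a" by (simp add: norm_mult mult.commute)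
  have "min 1 r * (?S powr (r - 1) * ?a powr q) \<le> ?S powr r - (?S - ?a powr q) powr r"
    using a S r_pos by (intro powr_decrement_ge) auto
  also have "\<dots> = energy p q f - energy p q (upd f j k 0)"
    using q by (simp add: energy_upd[OF f(1)])
  also have "\<dots> = ?u powr p - ?v powr p"
    using energy_eq_norm_powr[OF upd_lplq[OF f(1)]] energy_eq_norm_powr[OF f(1)] by metis
  also have "\<dots> \<le> p * ?u powr (p - 1) * (?u - ?v)"
    using powr_ge_tangent[of p ?u ?v] p u lplq_norm_nonneg[of p q "upd f j k 0"] by (simp add: algebra_simps)
  also have "\<dots> \<le> p * ?u powr (p - 1) * (?d * ?a)"
    using uv p by (intro mult_left_mono) auto
  finally have "min 1 r * gain p q f j k \<le> p * (?u powr (p - 1) * (?d * ?a))"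
    by (simp add: gain_def mult_ac)
  then have "min 1 r * gain p q f j k / p \<le> ?u powr (p - 1) * (?d * ?a)"
    using p by (subst pos_divide_le_eq) (simp_all add: mult.commute)
  then show ?thesis by (simp add: gain_lb_def)
qed

text \<open>Pigeonhole: the part of \<open>f\<close> outside \<open>A\<close> contributes less than
  half of \<open>F f\<close>, so one of the at most \<open>N\<close> indices in \<open>A\<close>
  contributes more than \<open>?u / (2 * N)\<close>.\<close>

lemma exists_large_gain:
  assumes A: "finite A" "card A \<le> N" and small: "2 * lplq_norm p q (delete A f) < lplq_norm p q f"
  obtains j k where "(j, k) \<in> A" "f j k \<noteq> 0"
    "energy p q f / (2 * real N * gain_ub) \<le> gain p q f j k"
proof -
  let ?u = "lplq_norm p q f"
  have u: "0 < ?u" using f lplq_norm_pos by blast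
  have "?u = norm (F f)" using F u by (simp add: norming_functional_def)
  also have "\<dots> \<le> (\<Sum>(j, k)\<in>A. norm (F (unit_seq j k)) * norm (f j k)) + norm (F (delete A f))"
    by (rule norming_functional_support[OF F f(1) A(1)])
  also have "norm (F (delete A f)) \<le> lplq_norm p q (delete A f)"
    using norming_functional_bound[OF F] delete_lplq[OF f(1)] by blast
  finally have big: "?u / 2 < (\<Sum>(j, k)\<in>A. norm (F (unit_seq j k)) * norm (f j k))"
    using small by simp
  then have "A \<noteq> {}" using u by auto
  then have N: "0 < real N" using A by (metis card_gt_0_iff less_le_trans of_nat_0_less_iff)
  have "\<exists>(j, k)\<in>A. ?u / (2 * N) < norm (F (unit_seq j k)) * norm (f j k)"
  proof (rule ccontr)
    assume "\<not> ?thesis"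
    then have "(\<Sum>(j, k)\<in>A. norm (F (unit_seq j k)) * norm (f j k)) \<le> real (card A) * (?u / (2 * N))"
      by (intro sum_bounded_above) (auto simp: not_less)
    also have "\<dots> \<le> real N * (?u / (2 * N))"
      using A u by (intro mult_right_mono) auto
    also have "\<dots> = ?u / 2" using N by simp
    finally show False using big by simp
  qed
  then obtain j k where jk: "(j, k) \<in> A" "?u / (2 * N) < norm (F (unit_seq j k)) * norm (f j k)"
    by auto
  have "0 < ?u / (2 * N)" using u N by simp
  then have nz: "f j k \<noteq> 0" using jk by auto
  have "energy p q f = ?u powr (p - 1) * ?u"
    using u p powr_mult_base[of ?u "p - 1"] by (simp add: energy_eq_norm_powr[OF f(1)] mult.commute)
  then have "energy p q f / (2 * N) = ?u powr (p - 1) * (?u / (2 * N))" by simp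
  also have "\<dots> \<le> ?u powr (p - 1) * (norm (F (unit_seq j k)) * norm (f j k))"
    using jk by (intro mult_left_mono) auto
  also have "\<dots> \<le> gain_ub * gain p q f j k" by (rule norming_functional_le_gain)
  finally have "energy p q f / (2 * real N * gain_ub) \<le> gain p q f j k"
    using gain_ub_pos N by (simp add: pos_divide_le_eq mult_ac)
  then show ?thesis using that jk nz by blast
qed

end

end

section \<open>Greedy steps\<close>

text \<open>A run selects basis vectors; deletions are indexed by pairs. This recovers the pair,
  with an arbitrary value off the basis.\<close>

definition coord :: "(nat \<Rightarrow> nat \<Rightarrow> 'k::real_normed_field) \<Rightarrow> nat \<times> nat" where
  "coord y = (SOME e. y = unit_vec e)"

lemma unit_vec_coord: "y \<in> canonical_basis \<Longrightarrow> unit_vec (coord y) = y"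
proof -
  assume "y \<in> canonical_basis"
  then have "\<exists>e. y = unit_vec e" unfolding canonical_basis_def by auto
  then show ?thesis unfolding coord_def by (metis (mono_tags, lifting) someI_ex)
qed

lemma unit_vec_in_basis: "unit_vec e \<in> canonical_basis"
  by (auto simp: canonical_basis_def)

lemma sparse_support:
  fixes a :: "nat \<Rightarrow> nat \<Rightarrow> 'k::real_normed_field"
  assumes "a \<in> sparse canonical_basis N"
  obtains A where "finite A" "card A \<le> N" "a \<in> dspan (unit_vec ` A)"
proof -
  obtain S where S: "S \<subseteq> canonical_basis" "finite S" "card S \<le> N" "a \<in> dspan S"
    using assms by (auto simp: sparse_def)
  have "unit_vec ` coord ` S = S"
    using S(1) unit_vec_coord by (force simp: image_image)
  moreover have "card (coord ` S) \<le> N" using S card_image_le order_trans by blast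
  ultimately show ?thesis using that[of "coord ` S"] S by simp
qed

lemma span_delete_eq:
  assumes "a \<in> dspan (unit_vec ` \<Gamma>)"
  shows "delete \<Gamma> (x - a) = delete \<Gamma> x"
  using span_unit_vec_supported[OF assms] by (auto simp: delete_def fun_eq_iff)

context mixed_exponents
begin

text \<open>The finitely many deleted entries are put back one by one. Thus \<open>x - a\<close>
  lies in the space for every finite combination \<open>a\<close>, without appeal to the triangle
  inequality.\<close>

lemma lplq_if_delete_lplq:
  assumes "finite \<Gamma>" "delete \<Gamma> x \<in> lplq p q"
  shows "x \<in> lplq p q"
  using assms
proof induction
  case empty
  then show ?case by simp
next
  case (insert e \<Gamma>)
  have "delete \<Gamma> x = upd (delete (insert e \<Gamma>) x) (fst e) (snd e) (x (fst e) (snd e))"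
    using insert.hyps by (auto simp: delete_def upd_def fun_eq_iff)
  then show ?case using insert upd_lplq by metis
qed

section \<open>Best approximation from coordinate subspaces\<close>

context
  fixes x :: "nat \<Rightarrow> nat \<Rightarrow> 'k::real_normed_field" and \<Gamma> :: "(nat \<times> nat) set"
  assumes x: "x \<in> lplq p q" and \<Gamma>: "finite \<Gamma>"
begin

lemma minus_span_lplq: "a \<in> dspan (unit_vec ` \<Gamma>) \<Longrightarrow> x - a \<in> lplq p q"
  using lplq_if_delete_lplq[OF \<Gamma>] delete_lplq[OF x] span_delete_eq by metis

lemma norm_delete_le_minus_span:
  assumes "a \<in> dspan (unit_vec ` \<Gamma>)"
  shows "lplq_norm p q (delete \<Gamma> x) \<le> lplq_norm p q (x - a)"
  using norm_delete_antimono[OF minus_span_lplq[OF assms], of "{}" \<Gamma>] span_delete_eq[OF assms] by simp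

lemma dist_span: "lplq_dist p q x (dspan (unit_vec ` \<Gamma>)) = lplq_norm p q (delete \<Gamma> x)"
  unfolding lplq_dist_def
proof (rule cInf_eq_minimum)
  have "x - (x - delete \<Gamma> x) = delete \<Gamma> x" by simp
  then show "lplq_norm p q (delete \<Gamma> x) \<in> (\<lambda>a. lplq_norm p q (x - a)) ` dspan (unit_vec ` \<Gamma>)"
    using minus_delete_in_span[OF \<Gamma>, of x] by (intro image_eqI[of _ _ "x - delete \<Gamma> x"]) auto
qed (use norm_delete_le_minus_span in auto)

text \<open>A nonzero entry left inside \<open>\<Gamma>\<close> could be set to zero, which strictly
  lowers the norm and yet cannot go below that of the projection. Hence the free choice in a
  Chebyshev step is no choice at all.\<close>

lemma best_approximation_unique:
  assumes a: "a \<in> dspan (unit_vec ` \<Gamma>)"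
    and eq: "lplq_norm p q (x - a) = lplq_dist p q x (dspan (unit_vec ` \<Gamma>))"
  shows "x - a = delete \<Gamma> x"
proof (rule ccontr)
  assume "x - a \<noteq> delete \<Gamma> x"
  then obtain j k where jk: "(j, k) \<in> \<Gamma>" "(x - a) j k \<noteq> 0"
    using span_unit_vec_supported[OF a] by (fastforce simp: delete_def fun_eq_iff)
  have "delete \<Gamma> x = delete \<Gamma> (upd (x - a) j k 0)"
    using jk(1) span_delete_eq[OF a, of x, symmetric] by (auto simp: delete_def upd_def fun_eq_iff)
  then have "lplq_norm p q (delete \<Gamma> x) \<le> lplq_norm p q (upd (x - a) j k 0)"
    using norm_delete_antimono[OF upd_lplq[OF minus_span_lplq[OF a]], of "{}" \<Gamma>] by simp
  also have "\<dots> < lplq_norm p q (x - a)"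
    using delete_strict minus_span_lplq[OF a] jk(2) by blast
  finally show False using eq dist_span by simp
qed

lemma best_error_le:
  assumes "card \<Gamma> \<le> N"
  shows "best_error p q canonical_basis N x \<le> lplq_norm p q (delete \<Gamma> x)"
proof -
  have "x - delete \<Gamma> x \<in> sparse canonical_basis N"
    unfolding sparse_def
  proof (rule UN_I)
    show "x - delete \<Gamma> x \<in> dspan (unit_vec ` \<Gamma>)" by (rule minus_delete_in_span[OF \<Gamma>])
    show "unit_vec ` \<Gamma> \<in> {S. S \<subseteq> canonical_basis \<and> finite S \<and> card S \<le> N}"
      using \<Gamma> assms card_image_le[OF \<Gamma>, of unit_vec] unit_vec_in_basis by (auto intro: order_trans)
  qed
  then have "best_error p q canonical_basis N x \<le> lplq_norm p q (x - (x - delete \<Gamma> x))"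
    unfolding best_error_def lplq_dist_def
    by (intro cINF_lower bdd_belowI2[where m = 0]) (auto simp: lplq_norm_nonneg)
  then show ?thesis by simp
qed

end

lemma best_error_greatest:
  fixes x :: "nat \<Rightarrow> nat \<Rightarrow> 'k::real_normed_field"
  assumes x: "x \<in> lplq p q"
    and le: "\<And>A. finite A \<Longrightarrow> card A \<le> N \<Longrightarrow> L \<le> lplq_norm p q (delete A x)"
  shows "L \<le> best_error p q canonical_basis N x"
  unfolding best_error_def lplq_dist_def
proof (rule cINF_greatest)
  have "(0 :: nat \<Rightarrow> nat \<Rightarrow> 'k) \<in> sparse canonical_basis N"
    unfolding sparse_def by (rule UN_I[of "{}"]) (auto simp: dseq.span_zero)
  then show "sparse canonical_basis N \<noteq> ({} :: (nat \<Rightarrow> nat \<Rightarrow> 'k) set)" by blast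
next
  fix a :: "nat \<Rightarrow> nat \<Rightarrow> 'k" assume "a \<in> sparse canonical_basis N"
  then obtain A where A: "finite A" "card A \<le> N" "a \<in> dspan (unit_vec ` A)"
    by (rule sparse_support)
  then show "L \<le> lplq_norm p q (x - a)"
    using le norm_delete_le_minus_span[OF x] order_trans by blast
qed

text \<open>After a zero remainder the run is constant, so a nonzero remainder at time
  \<open>n\<close> means that all earlier steps were genuine; each of them is then determined by
  uniqueness of the best approximation.\<close>

lemma wcga_run_remainder:
  fixes x :: "nat \<Rightarrow> nat \<Rightarrow> 'k::real_normed_field"
  assumes x: "x \<in> lplq p q" and run: "wcga_run p q canonical_basis \<tau> x \<phi> G"
    and "x - G n \<noteq> 0"
  shows "(\<forall>m<n. \<phi> m \<in> canonical_basis \<and> x - G m \<noteq> 0) \<and> x - G n = delete ((\<lambda>m. coord (\<phi> m)) ` {..<n}) x"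
  using assms(3)
proof (induction n)
  case 0
  then show ?case using run by (simp add: wcga_run_def)
next
  case (Suc n)
  have nz: "x - G n \<noteq> 0" using run Suc.prems by (metis wcga_run_def)
  then have IH: "\<forall>m<n. \<phi> m \<in> canonical_basis \<and> x - G m \<noteq> 0" using Suc.IH by blast
  have step: "\<phi> n \<in> canonical_basis" "G (Suc n) \<in> dspan (\<phi> ` {..n})"
    "lplq_norm p q (x - G (Suc n)) = lplq_dist p q x (dspan (\<phi> ` {..n}))"
    using run nz unfolding wcga_run_def by presburger+
  have "\<phi> ` {..n} = unit_vec ` (\<lambda>m. coord (\<phi> m)) ` {..<Suc n}"
    unfolding image_image lessThan_Suc_atMost
    using IH step(1) by (intro image_cong[OF refl]) (auto simp: unit_vec_coord le_less)
  then have "x - G (Suc n) = delete ((\<lambda>m. coord (\<phi> m)) ` {..<Suc n}) x"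
    using best_approximation_unique[OF x, of "(\<lambda>m. coord (\<phi> m)) ` {..<Suc n}" "G (Suc n)"] step by simp
  then show ?case using IH step(1) nz less_Suc_eq by metis
qed

section \<open>Comparing gains with values of the norming functional\<close>

definition dual_max :: real where
  "dual_max = max (conj_exp p) (conj_exp q)"

definition dual_min :: real where
  "dual_min = min (conj_exp p) (conj_exp q)"

lemma dual_pos: "1 < dual_min" "dual_min \<le> dual_max"
  using p q by (auto simp: dual_min_def dual_max_def conj_exp_def)

lemma wcga_beta_eq: "wcga_beta p q = dual_max / dual_min"
proof -
  have *: "1 < conj_exp p" "1 < conj_exp q" using p q by (auto simp: conj_exp_def)
  show ?thesis
  proof (cases "conj_exp p \<le> conj_exp q")
    case True
    then have "conj_exp p / conj_exp q \<le> 1" "1 \<le> conj_exp q / conj_exp p" using * by auto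
    then show ?thesis using True by (simp add: wcga_beta_def dual_max_def dual_min_def max_def min_def)
  next
    case False
    then have "1 \<le> conj_exp p / conj_exp q" "conj_exp q / conj_exp p \<le> 1" using * by auto
    then show ?thesis using False by (simp add: wcga_beta_def dual_max_def dual_min_def max_def min_def)
  qed
qed

lemma wcga_beta_ge_1: "1 \<le> wcga_beta p q"
  using dual_pos by (simp add: wcga_beta_eq)

text \<open>Up to the factors \<open>gain_lb\<close> and \<open>gain_ub\<close>, \<open>W\<close> is
  the modulus of a norming functional of \<open>f\<close> on the basis vector. With the ratios
  \<open>b\<close> and \<open>t\<close>, both at most \<open>1\<close>, the relative gain and
  \<open>W\<close> are monomials whose exponents can be compared.\<close>

lemma gain_sandwich:
  fixes f :: "nat \<Rightarrow> nat \<Rightarrow> 'k::real_normed_field"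
  assumes f: "f \<in> lplq p q" and nz: "f j k \<noteq> 0"
  defines "W \<equiv> gain p q f j k / (norm (f j k) * lplq_norm p q f powr (p - 1))"
  shows "W powr dual_max \<le> gain p q f j k / energy p q f"
    "gain p q f j k / energy p q f \<le> W powr dual_min" "0 < W"
proof -
  let ?S = "row_energy q f j" and ?a = "norm (f j k)" and ?u = "lplq_norm p q f"
  have "f \<noteq> 0" using nz by auto
  then have u: "0 < ?u" using f lplq_norm_pos by blast
  have a: "0 < ?a powr q" "?a powr q \<le> ?S" using nz entry_le_row_energy[OF f] by auto
  then have S: "0 < ?S" by linarith
  define b where "b = ?S powr (1 / q) / ?u"
  define t where "t = ?a / ?S powr (1 / q)"
  have "?a = (?a powr q) powr (1 / q)" using q by (simp add: powr_powr)
  also have "\<dots> \<le> ?S powr (1 / q)" using a q by (intro powr_mono2) auto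
  finally have t: "0 < t" "t \<le> 1" using nz S by (auto simp: t_def)
  have "?S powr (1 / q) = (?S powr r) powr (1 / p)" using p by (simp add: powr_powr)
  also have "\<dots> \<le> ?u"
    unfolding lplq_norm_eq using row_le_energy[OF f] p by (intro powr_mono2) auto
  finally have b: "0 < b" "b \<le> 1" using u S by (auto simp: b_def)
  have E: "gain p q f j k / energy p q f = b powr p * t powr q"
    using p q S u by (simp add: gain_def energy_eq_norm_powr[OF f] b_def t_def powr_divide powr_powr powr_diff)
  have W: "W = b powr (p - 1) * t powr (q - 1)"
    using p q S u nz
    by (simp add: W_def gain_def b_def t_def powr_divide powr_powr powr_diff diff_divide_distrib mult_ac)
  show "0 < W" using b t by (simp add: W)
  \<comment> \<open>\<open>p = (p - 1) * conj_exp p\<close>, and likewise for \<open>q\<close>.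
    Since the bases are at most \<open>1\<close>, larger exponents give smaller powers.\<close>
  have ex: "p \<le> (p - 1) * dual_max" "q \<le> (q - 1) * dual_max"
    "(p - 1) * dual_min \<le> p" "(q - 1) * dual_min \<le> q"
    using p q mult_left_mono[of "conj_exp p" dual_max "p - 1"] mult_left_mono[of "conj_exp q" dual_max "q - 1"]
      mult_left_mono[of dual_min "conj_exp p" "p - 1"] mult_left_mono[of dual_min "conj_exp q" "q - 1"]
    by (auto simp: dual_max_def dual_min_def conj_exp_def)
  have "W powr dual_max = b powr ((p - 1) * dual_max) * t powr ((q - 1) * dual_max)"
    using b t by (simp add: W powr_mult powr_powr)
  also have "\<dots> \<le> b powr p * t powr q"
    using b t ex by (intro mult_mono powr_mono') auto
  finally show "W powr dual_max \<le> gain p q f j k / energy p q f" by (simp add: E)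
  have "b powr p * t powr q \<le> b powr ((p - 1) * dual_min) * t powr ((q - 1) * dual_min)"
    using b t ex by (intro mult_mono powr_mono') auto
  also have "\<dots> = W powr dual_min"
    using b t by (simp add: W powr_mult powr_powr)
  finally show "gain p q f j k / energy p q f \<le> W powr dual_min" by (simp add: E)
qed

context
  fixes f :: "nat \<Rightarrow> nat \<Rightarrow> 'k::real_normed_field" and F \<tau> j0 k0
  assumes f: "f \<in> lplq p q" "f \<noteq> 0" and F: "norming_functional p q f F"
    and \<tau>: "0 < \<tau>"
    and greedy: "\<tau> * (SUP \<psi>\<in>canonical_basis. norm (F \<psi>)) \<le> norm (F (unit_seq j0 k0))"
begin

lemma greedy_choice_dominates: "\<tau> * norm (F (unit_seq j k)) \<le> norm (F (unit_seq j0 k0))"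
proof -
  have "norm (F (unit_seq j k)) \<le> (SUP \<psi>\<in>canonical_basis. norm (F \<psi>))"
  proof (rule cSUP_upper)
    show "bdd_above ((\<lambda>\<psi>. norm (F \<psi>)) ` canonical_basis)"
      using norming_functional_bound[OF F unit_seq_lplq]
      by (intro bdd_aboveI2[where M = 1]) (auto simp: canonical_basis_def norm_unit_seq)
  qed (auto simp: canonical_basis_def)
  then show ?thesis using greedy \<tau> by (meson mult_left_mono order_trans less_imp_le)
qed

text \<open>If the picked entry were zero, \<open>F\<close> would vanish on it and, by weak
  greediness, on every basis vector; but a nonzero entry has positive gain, on which
  \<open>F\<close> cannot vanish.\<close>

lemma greedy_choice_nonzero: "f j0 k0 \<noteq> 0"
proof
  assume "f j0 k0 = 0"
  then have 0: "F (unit_seq j k) = 0" for j k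
    using norming_functional_eq_0[OF f F] greedy_choice_dominates[of j k] \<tau>
    by (simp add: mult_le_0_iff)
  obtain j k where jk: "f j k \<noteq> 0" using f(2) by (auto simp: fun_eq_iff)
  then have "0 < norm (f j k) powr q" by simp
  moreover from this have "0 < row_energy q f j"
    using entry_le_row_energy[OF f(1), of j k] by linarith
  ultimately have "0 < gain p q f j k" by (simp add: gain_def)
  then show False
    using norming_functional_ge_gain[OF f F, of j k] 0 gain_lb_pos by (simp add: mult_le_0_iff)
qed

text \<open>A good index in \<open>A\<close> has gain at least of order \<open>1/N\<close>, hence
  \<open>W\<close> at least of order \<open>N\<close> to the power \<open>-1/dual_min\<close>.
  Greediness passes this to the picked index, and returning from \<open>W\<close> to the gain costs
  the power \<open>dual_max\<close>.\<close>

lemma greedy_choice_gain: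
  assumes A: "finite A" "card A \<le> N" and small: "2 * lplq_norm p q (delete A f) < lplq_norm p q f"
  shows "(\<tau> * gain_lb / gain_ub) powr dual_max * (1 / (2 * gain_ub)) powr wcga_beta p q
      * energy p q f / real N powr wcga_beta p q \<le> gain p q f j0 k0"
proof -
  obtain j k where jk: "(j, k) \<in> A" "f j k \<noteq> 0"
    "energy p q f / (2 * real N * gain_ub) \<le> gain p q f j k"
    using exists_large_gain[OF f F A small] .
  then have "card A > 0" using A card_gt_0_iff by blast
  then have N: "0 < real N" using A by simp
  have u: "0 < lplq_norm p q f" using f lplq_norm_pos by blast
  then have e: "0 < energy p q f" using energy_eq_norm_powr[OF f(1)] by simp
  define W where "W j k = gain p q f j k / (norm (f j k) * lplq_norm p q f powr (p - 1))" for j k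
  \<comment> \<open>\<open>\<kappa>\<close> is the constant of the pigeonhole step;
    \<open>\<eta>\<close> is the loss in passing from one index to the other through
    \<open>F\<close>, whose comparison with \<open>W\<close> is used once in each direction.\<close>
  define \<kappa> where "\<kappa> = 1 / (2 * gain_ub)"
  define \<eta> where "\<eta> = \<tau> * gain_lb / gain_ub"
  have pos: "0 < \<kappa>" "0 < \<eta>" using gain_ub_pos gain_lb_pos \<tau> by (auto simp: \<kappa>_def \<eta>_def)
  have "\<kappa> / N \<le> gain p q f j k / energy p q f"
    using jk(3) e N gain_ub_pos by (simp add: \<kappa>_def field_simps)
  also have "\<dots> \<le> W j k powr dual_min"
    unfolding W_def by (rule gain_sandwich[OF f(1) jk(2)])
  finally have "(\<kappa> / N) powr (1 / dual_min) \<le> (W j k powr dual_min) powr (1 / dual_min)"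
    using pos N dual_pos by (intro powr_mono2) auto
  also have "\<dots> = W j k"
    using gain_nonneg[of f j k] dual_pos by (simp add: powr_powr W_def)
  finally have W1: "(\<kappa> / N) powr (1 / dual_min) \<le> W j k" .
  have "gain_lb * W j k \<le> norm (F (unit_seq j k))"
    using norming_functional_ge_gain[OF f F, of j k] jk(2) u by (simp add: W_def field_simps)
  then have "\<tau> * (gain_lb * W j k) \<le> norm (F (unit_seq j0 k0))"
    using greedy_choice_dominates[of j k] \<tau> by (meson mult_left_mono order_trans less_imp_le)
  also have "\<dots> \<le> gain_ub * W j0 k0"
    using norming_functional_le_gain[OF f F, of j0 k0] greedy_choice_nonzero u by (simp add: W_def field_simps)
  finally have "\<eta> * W j k \<le> W j0 k0"
    using gain_ub_pos by (simp add: \<eta>_def field_simps)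
  with W1 have W0: "\<eta> * (\<kappa> / N) powr (1 / dual_min) \<le> W j0 k0"
    using pos by (meson mult_left_mono order_trans less_imp_le)
  have "\<eta> powr dual_max * (\<kappa> / N) powr wcga_beta p q = (\<eta> * (\<kappa> / N) powr (1 / dual_min)) powr dual_max"
    using pos N by (simp add: powr_mult powr_powr wcga_beta_eq)
  also have "\<dots> \<le> W j0 k0 powr dual_max"
    using W0 pos dual_pos by (intro powr_mono2) auto
  also have "\<dots> \<le> gain p q f j0 k0 / energy p q f"
    unfolding W_def by (rule gain_sandwich[OF f(1) greedy_choice_nonzero])
  finally show ?thesis
    using e N pos unfolding \<eta>_def[symmetric] \<kappa>_def[symmetric] by (simp add: powr_divide field_simps)
qed

end

end

section \<open>The upper bound\<close>

text \<open>Telescoping; at indices outside \<open>I\<close> the potential merely must not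
  rise.\<close>

lemma sum_le_potential_drop:
  fixes E V :: "nat \<Rightarrow> real"
  assumes "m \<le> n"
    and "\<And>i. m \<le> i \<Longrightarrow> i < n \<Longrightarrow> V (Suc i) \<le> V i"
    and "\<And>i. m \<le> i \<Longrightarrow> i < n \<Longrightarrow> i \<in> I \<Longrightarrow> E i \<le> V i - V (Suc i)"
  shows "(\<Sum>i\<in>I \<inter> {m..<n}. E i) \<le> V m - V n"
  using assms
proof (induction n rule: dec_induct)
  case base
  then show ?case by simp
next
  case (step n)
  have IH: "(\<Sum>i\<in>I \<inter> {m..<n}. E i) \<le> V m - V n"
    using step.IH step.prems by simp
  have "I \<inter> {m..<Suc n} = (if n \<in> I then insert n (I \<inter> {m..<n}) else I \<inter> {m..<n})"
    using step.hyps by (auto simp: less_Suc_eq)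
  then show ?case
    using IH step.prems(1)[of n] step.prems(2)[of n] step.hyps by auto
qed

text \<open>
  Split \<open>{..<n}\<close> at the first index where \<open>u\<close> has dropped to twice its final value: the period
  hypothesis bounds the part after it, and the bounds for the parts before it decay geometrically.
\<close>

lemma card_le_by_halving:
  fixes u E :: "nat \<Rightarrow> real"
  assumes s: "0 < s" "s \<le> p" and c: "0 < c" and B: "0 \<le> B" and \<sigma>: "0 < \<sigma>"
    and pos: "\<And>m. m < n \<Longrightarrow> 0 < u m"
    and anti: "\<And>m m'. m \<le> m' \<Longrightarrow> m' < n \<Longrightarrow> u m' \<le> u m"
    and big: "\<And>m. m < n \<Longrightarrow> m \<in> I \<Longrightarrow> c * u m powr p \<le> E m"
    and period: "\<And>m l. m < l \<Longrightarrow> l \<le> n \<Longrightarrow> (\<Sum>i\<in>I \<inter> {m..<l}. E i) \<le> B * \<sigma> powr s * u m powr (p - s)"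
    and n: "0 < n"
  shows "real (card (I \<inter> {..<n})) \<le> B * 2 powr (p - s) / c / (1 - 2 powr (- s)) * (\<sigma> / u (n - 1)) powr s"
proof -
  define K where "K = B * 2 powr (p - s) / c"
  define K' where "K' = K / (1 - 2 powr (- s))"
  have two: "2 powr (- s) < 1" using powr_less_mono[of "- s" 0 2] s by simp
  have K: "0 \<le> K" using B c by (simp add: K_def)
  \<comment> \<open>\<open>K'\<close> is the sum of the geometric series with ratio
    \<open>2 powr (- s)\<close>, i.e. the constant that reproduces itself when the late part and the
    early part are added.\<close>
  have K'_eq: "K + 2 powr (- s) * K' = K'" 
  proof -
    have "K + w * (K / (1 - w)) = K / (1 - w)" if "w < 1" for w
      using that by (simp add: field_simps)
    then show ?thesis using two unfolding K'_def by blast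
  qed
  have K': "0 \<le> K'" using K two by (simp add: K'_def)
  have "real (card (I \<inter> {..<l})) \<le> K' * (\<sigma> / u (l - 1)) powr s" if "0 < l" "l \<le> n" for l
    using that
  proof (induction l rule: less_induct)
    case (less l)
    define v where "v = u (l - 1)"
    have v: "0 < v" using pos less.prems by (simp add: v_def)
    define m where "m = (LEAST m. u m \<le> 2 * v)"
    have "u (l - 1) \<le> 2 * v" using v by (simp add: v_def)
    then have um: "u m \<le> 2 * v" and ml: "m \<le> l - 1"
      unfolding m_def by (rule LeastI, rule Least_le)
    have ml': "m < l" using ml less.prems by simp
    have "real (card (I \<inter> {m..<l})) * (c * v powr p) \<le> (\<Sum>i\<in>I \<inter> {m..<l}. E i)"
    proof (rule sum_bounded_below)
      fix i assume i: "i \<in> I \<inter> {m..<l}"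
      then have "v \<le> u i" unfolding v_def using less.prems by (intro anti) auto
      then have "c * v powr p \<le> c * u i powr p"
        using v c s by (intro mult_left_mono powr_mono2) auto
      also have "\<dots> \<le> E i" using i less.prems by (intro big) auto
      finally show "c * v powr p \<le> E i" .
    qed
    also have "\<dots> \<le> B * \<sigma> powr s * u m powr (p - s)" using period ml' less.prems by simp
    also have "\<dots> \<le> B * \<sigma> powr s * (2 * v) powr (p - s)"
      using um pos[of m] ml' less.prems s B by (intro mult_left_mono powr_mono2) auto
    also have "\<dots> = K * (\<sigma> / v) powr s * (c * v powr p)"
      using v c \<sigma> by (simp add: K_def powr_mult powr_divide powr_diff)
    finally have late: "real (card (I \<inter> {m..<l})) \<le> K * (\<sigma> / v) powr s"
      using c v by simp
    \<comment> \<open>Induction hypothesis at \<open>m\<close>: by minimality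
      \<open>u (m - 1)\<close> exceeds \<open>2 * v\<close>, which contributes the factor
      \<open>2 powr (- s)\<close>.\<close>
    have early: "real (card (I \<inter> {..<m})) \<le> 2 powr (- s) * K' * (\<sigma> / v) powr s"
    proof (cases "m = 0")
      case True
      then show ?thesis using K' by simp
    next
      case False
      then have "2 * v < u (m - 1)" using not_less_Least[of "m - 1" "\<lambda>m. u m \<le> 2 * v"] by (simp add: m_def)
      then have "\<sigma> / u (m - 1) \<le> \<sigma> / (2 * v)" using v \<sigma> by (intro divide_left_mono) auto
      moreover have "0 < u (m - 1)" using \<open>2 * v < u (m - 1)\<close> v by linarith
      ultimately have "(\<sigma> / u (m - 1)) powr s \<le> (\<sigma> / (2 * v)) powr s"
        using \<sigma> s by (intro powr_mono2) auto
      also have "\<dots> = 2 powr (- s) * (\<sigma> / v) powr s"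
        using v \<sigma> by (simp add: powr_divide powr_mult powr_minus field_simps)
      finally have "K' * (\<sigma> / u (m - 1)) powr s \<le> K' * (2 powr (- s) * (\<sigma> / v) powr s)"
        using K' by (rule mult_left_mono)
      moreover have "real (card (I \<inter> {..<m})) \<le> K' * (\<sigma> / u (m - 1)) powr s"
        using less.IH[of m] False ml' less.prems by simp
      ultimately show ?thesis by (simp add: mult_ac)
    qed
    have "I \<inter> {..<l} = (I \<inter> {..<m}) \<union> (I \<inter> {m..<l})" using ml' by auto
    then have "card (I \<inter> {..<l}) \<le> card (I \<inter> {..<m}) + card (I \<inter> {m..<l})"
      using card_Un_le by metis
    then have "real (card (I \<inter> {..<l})) \<le> (K + 2 powr (- s) * K') * (\<sigma> / v) powr s"
      using late early by (simp add: algebra_simps)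
    then show ?case by (simp add: K'_eq v_def)
  qed
  then show ?thesis using n by (simp add: K'_def K_def)
qed

section \<open>Counting the picks outside a comparison set\<close>

context mixed_exponents
begin

text \<open>\<open>f m\<close> is the remainder after \<open>m\<close> picks. \<open>T m\<close>
  records the row energies of the entries outside \<open>A\<close> that have not been picked yet;
  this is the budget on which picks outside \<open>A\<close> draw, and its total never exceeds the
  energy of \<open>delete A x\<close>.\<close>

context
  fixes x :: "nat \<Rightarrow> nat \<Rightarrow> 'k::real_normed_field" and e :: "nat \<Rightarrow> nat \<times> nat" and n :: nat
    and A :: "(nat \<times> nat) set" and f and T and pick_gain
  assumes x: "x \<in> lplq p q"
    and nz: "\<And>m. m < n \<Longrightarrow> delete (e ` {..<m}) x (fst (e m)) (snd (e m)) \<noteq> 0"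
  defines "f \<equiv> \<lambda>m. delete (e ` {..<m}) x"
    and "T \<equiv> \<lambda>m. row_energy q (delete (A \<union> e ` {..<m}) x)"
    and "pick_gain \<equiv> \<lambda>m. gain p q (f m) (fst (e m)) (snd (e m))"
begin

lemma pick_new: "m < n \<Longrightarrow> e m \<notin> e ` {..<m}"
  using nz[of m] by (auto simp: delete_def split: if_splits)

lemma picks_inj: "inj_on e {..<n}"
proof (rule linorder_inj_onI')
  fix i j assume "i \<in> {..<n}" "j \<in> {..<n}" "i < j"
  then show "e i \<noteq> e j" using pick_new[of j] by (metis imageI lessThan_iff)
qed

lemma T_le_row_energy: "T m j \<le> row_energy q (f m) j"
  unfolding T_def f_def by (rule row_energy_delete_antimono[OF x]) auto

lemma T_nonneg: "0 \<le> T m j"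
  unfolding T_def by (intro row_energy_nonneg delete_lplq x)

lemma T_Suc_le: "T (Suc m) j \<le> T m j"
  unfolding T_def by (rule row_energy_delete_antimono[OF x]) auto

lemma T_Suc:
  assumes m: "m < n" "e m \<notin> A"
  shows "T (Suc m) (fst (e m)) = T m (fst (e m)) - norm (f m (fst (e m)) (snd (e m))) powr q"
proof -
  have "A \<union> e ` {..<Suc m} = insert (fst (e m), snd (e m)) (A \<union> e ` {..<m})"
    by (auto simp: lessThan_Suc)
  then have "delete (A \<union> e ` {..<Suc m}) x
      = upd (delete (A \<union> e ` {..<m}) x) (fst (e m)) (snd (e m)) 0"
    by (simp only: delete_insert)
  moreover have "delete (A \<union> e ` {..<m}) x (fst (e m)) (snd (e m)) = f m (fst (e m)) (snd (e m))"
    using m pick_new[OF m(1)] by (simp add: f_def delete_def)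
  ultimately show ?thesis
    using q by (simp add: T_def row_energy_upd[OF delete_lplq[OF x]])
qed

lemma entry_powr_le_T:
  assumes m: "m < n" "e m \<notin> A"
  shows "norm (f m (fst (e m)) (snd (e m))) powr q \<le> T m (fst (e m))"
  using T_Suc[OF m] T_nonneg[of "Suc m" "fst (e m)"] by linarith

text \<open>Bounds the gains by a potential summed over rows. Only the row of the pick has to pay;
  no other row can rise, as \<open>T\<close> decreases. \<open>J\<close> consists of the rows hit
  before time \<open>l\<close>, so the sum is finite. The two cases below differ in
  \<open>g\<close>.\<close>

lemma sum_pick_gain_le:
  assumes "m \<le> l" "l \<le> n"
    and nonneg: "\<And>j t. 0 \<le> t \<Longrightarrow> 0 \<le> g j t"
    and mono: "\<And>j t t'. 0 \<le> t \<Longrightarrow> t \<le> t' \<Longrightarrow> g j t \<le> (g j t' :: real)"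
    and drop: "\<And>i. m \<le> i \<Longrightarrow> i < l \<Longrightarrow> e i \<notin> A \<Longrightarrow>
      pick_gain i \<le> g (fst (e i)) (T i (fst (e i))) - g (fst (e i)) (T (Suc i) (fst (e i)))"
  shows "\<exists>J. finite J \<and> (\<Sum>i\<in>{i. e i \<notin> A} \<inter> {m..<l}. pick_gain i) \<le> (\<Sum>j\<in>J. g j (T m j))"
proof -
  define J where "J = (\<lambda>i. fst (e i)) ` {..<l}"
  define V where "V i = (\<Sum>j\<in>J. g j (T i j))" for i
  have "(\<Sum>i\<in>{i. e i \<notin> A} \<inter> {m..<l}. pick_gain i) \<le> V m - V l"
  proof (rule sum_le_potential_drop[OF assms(1)])
    show "V (Suc i) \<le> V i" for i
      unfolding V_def by (intro sum_mono mono T_nonneg T_Suc_le)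
    fix i assume i: "m \<le> i" "i < l" "i \<in> {i. e i \<notin> A}"
    have "pick_gain i \<le> g (fst (e i)) (T i (fst (e i))) - g (fst (e i)) (T (Suc i) (fst (e i)))"
      using drop i by simp
    also have "\<dots> \<le> (\<Sum>j\<in>J. g j (T i j) - g j (T (Suc i) j))"
      using i mono[OF T_nonneg T_Suc_le]
      by (intro member_le_sum[where f = "\<lambda>j. g j (T i j) - g j (T (Suc i) j)"]) (auto simp: J_def)
    also have "\<dots> = V i - V (Suc i)" by (simp add: V_def sum_subtractf)
    finally show "pick_gain i \<le> V i - V (Suc i)" .
  qed
  moreover have "0 \<le> V l" unfolding V_def by (intro sum_nonneg nonneg T_nonneg)
  moreover have "finite J" by (simp add: J_def)
  ultimately show ?thesis unfolding V_def by (intro exI[of _ J]) linarith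
qed

lemma finite_sum_T_powr_le:
  assumes "finite J"
  shows "(\<Sum>j\<in>J. T m j powr r) \<le> lplq_norm p q (delete A x) powr p"
proof -
  have "(\<Sum>j\<in>J. T m j powr r) \<le> energy p q (delete (A \<union> e ` {..<m}) x)"
    unfolding T_def energy_def
    by (intro sum_le_suminf assms energy_summable delete_lplq x) auto
  also have "\<dots> \<le> energy p q (delete A x)"
    by (rule energy_mono[OF delete_lplq[OF x]]) (auto simp: delete_def)
  finally show ?thesis by (simp add: energy_eq_norm_powr delete_lplq x)
qed

text \<open>For \<open>r \<le> 1\<close> the factor \<open>row_energy powr (r - 1)\<close> grows
  when the row energy is replaced by the smaller \<open>T\<close>, and concavity turns the result
  into a drop of \<open>T powr r\<close>.\<close>

lemma period_bound_le:
  assumes "p \<le> q" "m \<le> l" "l \<le> n"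
  shows "(\<Sum>i\<in>{i. e i \<notin> A} \<inter> {m..<l}. pick_gain i) \<le> 1 / r * lplq_norm p q (delete A x) powr p"
proof -
  have r: "r \<le> 1" using assms(1) q by simp
  have "\<exists>J. finite J \<and> (\<Sum>i\<in>{i. e i \<notin> A} \<inter> {m..<l}. pick_gain i) \<le> (\<Sum>j\<in>J. 1 / r * T m j powr r)"
  proof (rule sum_pick_gain_le[OF assms(2,3)])
    fix i assume "m \<le> i" "i < l" "e i \<notin> A"
    then have i: "i < n" "e i \<notin> A" using assms by auto
    let ?j = "fst (e i)" and ?a = "norm (f i (fst (e i)) (snd (e i)))"
    have a: "0 < ?a powr q" using nz[OF i(1)] by (simp add: f_def)
    then have T: "0 < T i ?j" using entry_powr_le_T[OF i] by linarith
    have "row_energy q (f i) ?j powr (r - 1) \<le> T i ?j powr (r - 1)"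
      using r T T_le_row_energy by (intro powr_mono2') auto
    then have "r * pick_gain i \<le> r * (T i ?j powr (r - 1) * ?a powr q)"
      unfolding pick_gain_def gain_def using r_pos by (intro mult_left_mono mult_right_mono) auto
    also have "\<dots> \<le> T i ?j powr r - T (Suc i) ?j powr r"
      using powr_decrement_ge[of r "T i ?j" "?a powr q"] r_pos r T entry_powr_le_T[OF i] T_Suc[OF i]
      by (simp add: min_def split: if_splits)
    finally have "pick_gain i \<le> (T i ?j powr r - T (Suc i) ?j powr r) / r"
      using r_pos by (subst pos_le_divide_eq) (auto simp: mult.commute)
    then show "pick_gain i \<le> 1 / r * T i ?j powr r - 1 / r * T (Suc i) ?j powr r"
      by (simp add: right_diff_distrib diff_divide_distrib left_diff_distrib mult.commute)
  qed (use r_pos p q in \<open>auto intro!: mult_left_mono divide_right_mono powr_mono2\<close>)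
  then obtain J where J: "finite J"
    "(\<Sum>i\<in>{i. e i \<notin> A} \<inter> {m..<l}. pick_gain i) \<le> (\<Sum>j\<in>J. 1 / r * T m j powr r)" by blast
  note J(2)
  also have "(\<Sum>j\<in>J. 1 / r * T m j powr r) = 1 / r * (\<Sum>j\<in>J. T m j powr r)"
    by (simp only: sum_distrib_left)
  also have "\<dots> \<le> 1 / r * lplq_norm p q (delete A x) powr p"
    using r_pos p q finite_sum_T_powr_le[OF J(1)] by (intro mult_left_mono) auto
  finally show ?thesis .
qed

text \<open>For \<open>r \<ge> 1\<close> that replacement goes the wrong way. Instead the factor is
  frozen at its value at time \<open>m\<close>, which is an upper bound later on, so the potential
  is linear in \<open>T\<close>; the mixed sum is then split in the manner of Young.\<close>

lemma period_bound_ge: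
  assumes "q \<le> p" "m \<le> l" "l \<le> n" and \<sigma>: "0 < lplq_norm p q (delete A x)" and u: "0 < lplq_norm p q (f m)"
  shows "(\<Sum>i\<in>{i. e i \<notin> A} \<inter> {m..<l}. pick_gain i)
    \<le> 2 * lplq_norm p q (delete A x) powr q * lplq_norm p q (f m) powr (p - q)"
proof -
  have r: "1 \<le> r" using assms(1) q by simp
  let ?\<sigma> = "lplq_norm p q (delete A x)" and ?u = "lplq_norm p q (f m)"
  define X where "X = row_energy q (f m)"
  have fm: "f m \<in> lplq p q" by (simp add: f_def delete_lplq x)
  have X: "0 \<le> X j" for j by (simp add: X_def row_energy_nonneg fm)
  have "\<exists>J. finite J \<and> (\<Sum>i\<in>{i. e i \<notin> A} \<inter> {m..<l}. pick_gain i) \<le> (\<Sum>j\<in>J. X j powr (r - 1) * T m j)"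
  proof (rule sum_pick_gain_le[OF assms(2,3)])
    fix i assume mi: "m \<le> i" "i < l" "e i \<notin> A"
    then have i: "i < n" "e i \<notin> A" using assms by auto
    let ?j = "fst (e i)" and ?a = "norm (f i (fst (e i)) (snd (e i)))"
    have fi: "f i \<in> lplq p q" by (simp add: f_def delete_lplq x)
    have "row_energy q (f i) ?j \<le> X ?j"
      unfolding X_def f_def using mi by (intro row_energy_delete_antimono[OF x]) auto
    then have "row_energy q (f i) ?j powr (r - 1) \<le> X ?j powr (r - 1)"
      using r row_energy_nonneg[OF fi] by (intro powr_mono2) auto
    then have "pick_gain i \<le> X ?j powr (r - 1) * ?a powr q"
      unfolding pick_gain_def gain_def by (intro mult_right_mono) auto
    then show "pick_gain i \<le> X ?j powr (r - 1) * T i ?j - X ?j powr (r - 1) * T (Suc i) ?j"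
      by (simp add: T_Suc[OF i] right_diff_distrib)
  qed (auto intro: mult_left_mono)
  then obtain J where J: "finite J"
    "(\<Sum>i\<in>{i. e i \<notin> A} \<inter> {m..<l}. pick_gain i) \<le> (\<Sum>j\<in>J. X j powr (r - 1) * T m j)" by blast
  \<comment> \<open>This threshold balances the two terms: each becomes
    \<open>?\<sigma> powr q * ?u powr (p - q)\<close>.\<close>
  define \<theta> where "\<theta> = (?\<sigma> / ?u) powr q"
  have \<theta>: "0 < \<theta>" using \<sigma> u by (simp add: \<theta>_def)
  \<comment> \<open>Either \<open>T m j\<close> is at most \<open>\<theta> * X j\<close>, or
    \<open>X j\<close> is at most \<open>T m j / \<theta>\<close>; substitute accordingly.\<close>
  have young: "X j powr (r - 1) * T m j \<le> \<theta> * X j powr r + \<theta> powr (1 - r) * T m j powr r" for j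
  proof (cases "T m j \<le> \<theta> * X j")
    case True
    then have "X j powr (r - 1) * T m j \<le> X j powr (r - 1) * (\<theta> * X j)"
      by (intro mult_left_mono) auto
    also have "\<dots> = \<theta> * X j powr r" using X[of j] powr_mult_base[of "X j" "r - 1"] by (simp add: mult_ac)
    finally show ?thesis by (simp add: add_increasing2)
  next
    case False
    then have "X j \<le> T m j / \<theta>" using \<theta> by (simp add: field_simps)
    then have "X j powr (r - 1) \<le> (T m j / \<theta>) powr (r - 1)"
      using X r by (intro powr_mono2) auto
    then have "X j powr (r - 1) * T m j \<le> (T m j / \<theta>) powr (r - 1) * T m j"
      using T_nonneg by (intro mult_right_mono) auto
    also have "\<dots> = \<theta> powr (1 - r) * (T m j powr (r - 1) * T m j)"
      using \<theta> T_nonneg[of m j] by (simp add: powr_divide powr_diff field_simps)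
    also have "T m j powr (r - 1) * T m j = T m j powr r"
      using T_nonneg[of m j] powr_mult_base[of "T m j" "r - 1"] by (simp add: mult_ac)
    finally show ?thesis using \<theta> by (simp add: add_increasing)
  qed
  note J(2)
  also have "(\<Sum>j\<in>J. X j powr (r - 1) * T m j)
     \<le> (\<Sum>j\<in>J. \<theta> * X j powr r + \<theta> powr (1 - r) * T m j powr r)"
    by (intro sum_mono young)
  also have "\<dots> = \<theta> * (\<Sum>j\<in>J. X j powr r) + \<theta> powr (1 - r) * (\<Sum>j\<in>J. T m j powr r)"
    by (simp add: sum.distrib sum_distrib_left)
  also have "\<dots> \<le> \<theta> * energy p q (f m) + \<theta> powr (1 - r) * ?\<sigma> powr p"
    unfolding energy_def X_def using \<theta> finite_sum_T_powr_le[OF J(1)]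
    by (intro add_mono mult_left_mono sum_le_suminf J energy_summable fm) auto
  also have "\<theta> * energy p q (f m) = ?\<sigma> powr q * ?u powr (p - q)"
    using \<sigma> u by (simp add: \<theta>_def energy_eq_norm_powr[OF fm] powr_divide powr_diff)
  also have "\<theta> powr (1 - r) * ?\<sigma> powr p = ?\<sigma> powr q * ?u powr (p - q)"
  proof -
    have "\<theta> powr (1 - r) = (?\<sigma> / ?u) powr (q - p)"
      using q by (simp add: \<theta>_def powr_powr right_diff_distrib)
    then show ?thesis using \<sigma> u by (simp add: powr_divide powr_diff field_simps)
  qed
  finally show ?thesis by simp
qed

lemma period_bound:
  assumes "m \<le> l" "l \<le> n" and "0 < lplq_norm p q (delete A x)" "0 < lplq_norm p q (f m)"
  shows "(\<Sum>i\<in>{i. e i \<notin> A} \<inter> {m..<l}. pick_gain i)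
    \<le> max 2 (1 / r) * lplq_norm p q (delete A x) powr (min p q) * lplq_norm p q (f m) powr (p - min p q)"
proof (cases "p \<le> q")
  case True
  have "(\<Sum>i\<in>{i. e i \<notin> A} \<inter> {m..<l}. pick_gain i) \<le> 1 / r * lplq_norm p q (delete A x) powr p"
    by (rule period_bound_le[OF True assms(1,2)])
  also have "\<dots> \<le> max 2 (1 / r) * lplq_norm p q (delete A x) powr p" by (intro mult_right_mono) auto
  \<comment> \<open>Here the last factor has exponent \<open>0\<close>; it equals \<open>1\<close>
    because the norm is positive, whereas \<open>0 powr 0 = 0\<close>.\<close>
  finally show ?thesis using True assms(4) by (simp add: min_def)
next
  case False
  have "(\<Sum>i\<in>{i. e i \<notin> A} \<inter> {m..<l}. pick_gain i)
    \<le> 2 * lplq_norm p q (delete A x) powr q * lplq_norm p q (f m) powr (p - q)"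
    by (rule period_bound_ge) (use False assms in auto)
  also have "\<dots> \<le> max 2 (1 / r) * lplq_norm p q (delete A x) powr q * lplq_norm p q (f m) powr (p - q)"
    by (intro mult_right_mono) auto
  finally show ?thesis using False by (simp add: min_def)
qed

text \<open>Picks are distinct, so at most \<open>card A\<close> of them lie in \<open>A\<close>;
  those outside are counted by the halving argument with \<open>s = min p q\<close>.\<close>

lemma picks_count:
  assumes A: "finite A" "card A \<le> N" and N: "1 \<le> N" and c: "0 < c"
    and large: "\<And>m. m < n \<Longrightarrow> 2 * lplq_norm p q (delete A x) < lplq_norm p q (f m)"
    and gains: "\<And>m. m < n \<Longrightarrow> c * energy p q (f m) / real N powr \<beta> \<le> pick_gain m"
  shows "real n \<le> real N + max 2 (1 / r) * 2 powr (p - min p q) / c / (1 - 2 powr (- min p q)) * real N powr \<beta>"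
proof -
  let ?I = "{i. e i \<notin> A}" and ?s = "min p q" and ?\<sigma> = "lplq_norm p q (delete A x)"
  define K where "K = max 2 (1 / r) * 2 powr (p - ?s) / c / (1 - 2 powr (- ?s))"
  have s: "0 < ?s" using p q by simp
  have "2 powr (- ?s) < 1" using powr_less_mono[of "- ?s" 0 2] s by simp
  then have K: "0 \<le> K" using c by (simp add: K_def)
  have flp: "f m \<in> lplq p q" for m by (simp add: f_def delete_lplq x)
  have "real (card (?I \<inter> {..<n})) \<le> K * real N powr \<beta>"
  \<comment> \<open>If \<open>?\<sigma> = 0\<close>, then \<open>x\<close> vanishes outside
    \<open>A\<close> and no pick, having a nonzero entry, lies there.\<close>
  proof (cases "?\<sigma> = 0 \<or> n = 0")
    case True
    have "?I \<inter> {..<n} = {}" if "?\<sigma> = 0"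
    proof -
      have "delete A x = 0" using that lplq_norm_pos[OF delete_lplq[OF x]] by force
      then have "x (fst (e i)) (snd (e i)) = 0" if "e i \<notin> A" for i
        using that by (metis delete_def prod.collapse zero_fun_apply)
      then show ?thesis using nz by (force simp: delete_def split: if_splits)
    qed
    then show ?thesis using K True by auto
  next
    case False
    then have \<sigma>: "0 < ?\<sigma>" using lplq_norm_nonneg[of p q "delete A x"] by linarith
    have pos: "0 < lplq_norm p q (f m)" if "m < n" for m using large[OF that] \<sigma> by linarith
    have "real (card (?I \<inter> {..<n})) \<le> max 2 (1 / r) * 2 powr (p - ?s) / (c / real N powr \<beta>) / (1 - 2 powr (- ?s))
       * (?\<sigma> / lplq_norm p q (f (n - 1))) powr ?s"
    proof (rule card_le_by_halving[where E = pick_gain])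
      show "lplq_norm p q (f m') \<le> lplq_norm p q (f m)" if "m \<le> m'" for m m'
        unfolding f_def using that by (intro norm_delete_antimono[OF x]) auto
      show "c / real N powr \<beta> * lplq_norm p q (f m) powr p \<le> pick_gain m" if "m < n" for m
        using gains[OF that] by (simp add: energy_eq_norm_powr flp)
      show "(\<Sum>i\<in>?I \<inter> {m..<l}. pick_gain i) \<le> max 2 (1 / r) * ?\<sigma> powr ?s * lplq_norm p q (f m) powr (p - ?s)"
        if "m < l" "l \<le> n" for m l
        using that pos \<sigma> by (intro period_bound) auto
    qed (use s c N \<sigma> pos False in auto)
    also have "\<dots> = K * real N powr \<beta> * (?\<sigma> / lplq_norm p q (f (n - 1))) powr ?s"
      by (simp add: K_def)
    also have "\<dots> \<le> K * real N powr \<beta> * 1"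
    proof (rule mult_left_mono)
      have "?\<sigma> / lplq_norm p q (f (n - 1)) \<le> 1"
        \<comment> \<open>Even the last remainder exceeds \<open>2 * ?\<sigma>\<close>, so the ratio
          in the halving bound is below one.\<close>
        using large[of "n - 1"] pos[of "n - 1"] False \<sigma> by simp
      then show "(?\<sigma> / lplq_norm p q (f (n - 1))) powr ?s \<le> 1"
        using \<sigma> s pos[of "n - 1"] False by (intro powr_le1) auto
    qed (use K in auto)
    finally show ?thesis by simp
  qed
  moreover have "card (- ?I \<inter> {..<n}) \<le> card A"
    by (rule card_inj_on_le[where f = e]) (auto intro: inj_on_subset[OF picks_inj] A)
  moreover have "card {..<n} \<le> card (- ?I \<inter> {..<n}) + card (?I \<inter> {..<n})"
    using card_Un_le[of "- ?I \<inter> {..<n}" "?I \<inter> {..<n}"] by (simp add: Int_Un_distrib2[symmetric])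
  ultimately show ?thesis using A(2) unfolding K_def by simp
qed

end

text \<open>If the remainder at time \<open>n\<close> were more than twice the error of some
  \<open>A\<close>, so would be all earlier ones, every pick would have a large gain, and the count
  of picks would contradict the choice of \<open>n\<close>.\<close>

lemma wcga_lebesgue_upper:
  assumes \<tau>: "0 < \<tau>"
  shows "\<exists>c>0. \<exists>C>0. wcga_lebesgue TYPE('k::real_normed_field) p q \<tau>
    (\<lambda>N. nat \<lfloor>c * real N powr wcga_beta p q\<rfloor>) C"
proof -
  define c0 where "c0 = (\<tau> * gain_lb / gain_ub) powr dual_max * (1 / (2 * gain_ub)) powr wcga_beta p q"
  define K where "K = max 2 (1 / r) * 2 powr (p - min p q) / c0 / (1 - 2 powr (- min p q))"
  have c0: "0 < c0" using gain_lb_pos gain_ub_pos \<tau> by (simp add: c0_def)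
  have "2 powr (- min p q) < 1" using powr_less_mono[of "- min p q" 0 2] p q by simp
  then have K: "0 \<le> K" using c0 by (simp add: K_def)
  \<comment> \<open>The \<open>3\<close> absorbs the picks inside \<open>A\<close>, since
    \<open>N \<le> N powr \<beta>\<close>, and the rounding by the floor.\<close>
  have "wcga_lebesgue TYPE('k) p q \<tau> (\<lambda>N. nat \<lfloor>(K + 3) * real N powr wcga_beta p q\<rfloor>) 2"
    unfolding wcga_lebesgue_def
  proof (intro allI impI ballI)
    fix N :: nat and x :: "nat \<Rightarrow> nat \<Rightarrow> 'k" and \<phi> G
    assume N: "1 \<le> N" and x: "x \<in> (lplq p q :: (nat \<Rightarrow> nat \<Rightarrow> 'k) set)"
      and run: "wcga_run p q canonical_basis \<tau> x \<phi> G"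
    define n where "n = nat \<lfloor>(K + 3) * real N powr wcga_beta p q\<rfloor>"
    have Nb: "real N \<le> real N powr wcga_beta p q"
      using powr_mono[OF wcga_beta_ge_1, of "real N"] N by simp
    then have n: "real N + K * real N powr wcga_beta p q < real n"
      using N K unfolding n_def by (simp add: algebra_simps) linarith
    have "lplq_norm p q (x - G n) \<le> 2 * lplq_norm p q (delete A x)" if A: "finite A" "card A \<le> N" for A
    proof (rule ccontr)
      assume neg: "\<not> ?thesis"
      then have nz: "x - G n \<noteq> 0"
        using lplq_norm_nonneg[of p q "delete A x"] by (auto simp: lplq_norm_zero)
      define e where "e = (\<lambda>m. coord (\<phi> m))"
      define f where "f = (\<lambda>m. delete (e ` {..<m}) x)"
      have rem: "x - G m = f m" if "m \<le> n" for m
      proof -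
        have "x - G m \<noteq> 0"
          using wcga_run_remainder[OF x run nz] nz that by (cases "m = n") auto
        then show ?thesis
          using wcga_run_remainder[OF x run, of m] unfolding f_def e_def by blast
      qed
      have flp: "f m \<in> lplq p q" for m by (simp add: f_def delete_lplq x)
      have large: "2 * lplq_norm p q (delete A x) < lplq_norm p q (f m)" if "m \<le> n" for m
      proof -
        have "lplq_norm p q (f n) \<le> lplq_norm p q (f m)"
          unfolding f_def using that by (intro norm_delete_antimono[OF x]) auto
        then show ?thesis using neg rem[of n] by simp
      qed
      have step: "f m (fst (e m)) (snd (e m)) \<noteq> 0 \<and>
        c0 * energy p q (f m) / real N powr wcga_beta p q \<le> gain p q (f m) (fst (e m)) (snd (e m))"
        if m: "m < n" for m
      proof -
        have fnz: "f m \<noteq> 0" "\<phi> m \<in> canonical_basis"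
          using wcga_run_remainder[OF x run nz] m rem[of m] by auto
        then have e: "unit_seq (fst (e m)) (snd (e m)) = \<phi> m"
          by (simp add: e_def unit_vec_coord)
        obtain F where F: "norming_functional p q (f m) F"
          "\<tau> * (SUP \<psi>\<in>canonical_basis. norm (F \<psi>)) \<le> norm (F (\<phi> m))"
          using run fnz rem[of m] m unfolding wcga_run_def by (metis less_imp_le)
        have g: "\<tau> * (SUP \<psi>\<in>canonical_basis. norm (F \<psi>)) \<le> norm (F (unit_seq (fst (e m)) (snd (e m))))"
          using F(2) by (simp add: e)
        have "lplq_norm p q (delete A (f m)) \<le> lplq_norm p q (delete A x)"
          unfolding f_def delete_delete by (intro norm_delete_antimono[OF x]) auto
        then have "2 * lplq_norm p q (delete A (f m)) < lplq_norm p q (f m)"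
          using large[of m] m by simp
        then show ?thesis
          using greedy_choice_nonzero[OF flp fnz(1) F(1) \<tau> g]
            greedy_choice_gain[OF flp fnz(1) F(1) \<tau> g A] unfolding c0_def by blast
      qed
      have "real n \<le> real N + max 2 (1 / r) * 2 powr (p - min p q) / c0 / (1 - 2 powr (- min p q))
         * real N powr wcga_beta p q"
        by (rule picks_count[where e = e, OF x _ A N c0])
          (use step large in \<open>auto simp: f_def\<close>)
      then show False using n by (simp add: K_def)
    qed
    then have "lplq_norm p q (x - G n) / 2 \<le> best_error p q canonical_basis N x"
      using N by (intro best_error_greatest[OF x]) (auto simp: field_simps)
    then show "lplq_norm p q (x - G (nat \<lfloor>(K + 3) * real N powr wcga_beta p q\<rfloor>))
       \<le> 2 * best_error p q canonical_basis N x"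
      by (simp add: n_def)
  qed
  moreover have "0 < K + 3" using K by simp
  ultimately show ?thesis by (meson zero_less_numeral)
qed

end

section \<open>The lower bound\<close>

text \<open>For finitely supported \<open>x \<noteq> 0\<close> a norming functional can be chosen
  whose moduli on the basis are these numbers times the common factor
  \<open>lplq_norm p q x powr (1 - p)\<close>.\<close>

definition weight :: "real \<Rightarrow> real \<Rightarrow> (nat \<Rightarrow> nat \<Rightarrow> 'k::real_normed_field) \<Rightarrow> nat \<times> nat \<Rightarrow> real" where
  "weight p q x e = row_energy q x (fst e) powr (p / q - 1) * norm (x (fst e) (snd e)) powr (q - 1)"

definition supported_in_square :: "nat \<Rightarrow> (nat \<Rightarrow> nat \<Rightarrow> 'k::zero) \<Rightarrow> bool" where
  "supported_in_square L x \<longleftrightarrow> (\<forall>j k. x j k \<noteq> 0 \<longrightarrow> j < L \<and> k < L)"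

text \<open>The pick of the strict algorithm, hence admissible for every
  \<open>\<tau> \<le> 1\<close>; ties may be resolved at will, which the examples exploit.\<close>

definition greedy_index :: "real \<Rightarrow> real \<Rightarrow> (nat \<Rightarrow> nat \<Rightarrow> 'k::real_normed_field) \<Rightarrow> nat \<times> nat \<Rightarrow> bool" where
  "greedy_index p q x e \<longleftrightarrow> (\<forall>e'. weight p q x e' \<le> weight p q x e)"

lemma supported_in_square_delete: "supported_in_square L x \<Longrightarrow> supported_in_square L (delete \<Gamma> x)"
  by (auto simp: supported_in_square_def delete_def)

context mixed_exponents
begin

section \<open>Explicit norming functionals of finitely supported sequences\<close>

lemma square_row_energy:
  assumes "supported_in_square L x"
  shows "row_energy q x j = (\<Sum>k<L. norm (x j k) powr q)"
  unfolding row_energy_def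
  by (rule suminf_finite) (use assms in \<open>auto simp: supported_in_square_def\<close>)

lemma square_row_energy_0:
  assumes "supported_in_square L x" "L \<le> j"
  shows "row_energy q x j = 0"
proof -
  have "x j k = 0" for k using assms by (meson not_less supported_in_square_def)
  then show ?thesis by (simp add: row_energy_def)
qed

lemma square_energy:
  assumes "supported_in_square L x"
  shows "energy p q x = (\<Sum>j<L. row_energy q x j powr r)"
  unfolding energy_def
  by (rule suminf_finite) (use square_row_energy_0[OF assms] in auto)

lemma square_lplq:
  assumes "supported_in_square L x"
  shows "x \<in> lplq p q"
  unfolding lplq_iff
proof (intro conjI allI)
  show "summable (\<lambda>k. norm (x j k) powr q)" for j
    by (rule summable_finite[of "{..<L}"]) (use assms in \<open>auto simp: supported_in_square_def\<close>)
  show "summable (\<lambda>j. row_energy q x j powr r)"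
    by (rule summable_finite[of "{..<L}"]) (use square_row_energy_0[OF assms] in auto)
qed

text \<open>Hoelder twice: with exponent \<open>q\<close> inside each row, then with exponent
  \<open>p\<close> across the rows. The powers of the row energy combine as
  \<open>r - 1 + (q - 1) / q = (p - 1) / q\<close>.\<close>

lemma weighted_sum_le:
  assumes f: "supported_in_square L f" and y: "y \<in> lplq p q"
  shows "(\<Sum>j<L. \<Sum>k<L. weight p q f (j, k) * norm (y j k)) \<le> lplq_norm p q f powr (p - 1) * lplq_norm p q y"
proof -
  have "(\<Sum>k<L. weight p q f (j, k) * norm (y j k))
      \<le> (row_energy q f j powr (1 / q)) powr (p - 1) * row_energy q y j powr (1 / q)" for j
  proof -
    have "(\<Sum>k<L. norm (f j k) powr (q - 1) * norm (y j k))
        \<le> (\<Sum>k<L. norm (f j k) powr q) powr ((q - 1) / q) * (\<Sum>k<L. norm (y j k) powr q) powr (1 / q)"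
      by (rule Holder_sum) (use q in auto)
    also have "\<dots> \<le> row_energy q f j powr ((q - 1) / q) * row_energy q y j powr (1 / q)"
      unfolding square_row_energy[OF f]
      unfolding row_energy_def
      using q by (intro mult_left_mono powr_mono2 sum_le_suminf row_summable y sum_nonneg) auto
    finally have "row_energy q f j powr (r - 1) * (\<Sum>k<L. norm (f j k) powr (q - 1) * norm (y j k))
       \<le> row_energy q f j powr (r - 1) * (row_energy q f j powr ((q - 1) / q) * row_energy q y j powr (1 / q))"
      by (rule mult_left_mono) simp
    also have "\<dots> = row_energy q f j powr (r - 1 + (q - 1) / q) * row_energy q y j powr (1 / q)"
      by (simp add: powr_add)
    also have "row_energy q f j powr (r - 1 + (q - 1) / q) = (row_energy q f j powr (1 / q)) powr (p - 1)"
      using q by (simp add: powr_powr field_simps)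
    finally show ?thesis by (simp add: weight_def sum_distrib_left mult.assoc)
  qed
  then have "(\<Sum>j<L. \<Sum>k<L. weight p q f (j, k) * norm (y j k))
     \<le> (\<Sum>j<L. (row_energy q f j powr (1 / q)) powr (p - 1) * row_energy q y j powr (1 / q))"
    by (rule sum_mono)
  also have "\<dots> \<le> (\<Sum>j<L. (row_energy q f j powr (1 / q)) powr p) powr ((p - 1) / p)
      * (\<Sum>j<L. (row_energy q y j powr (1 / q)) powr p) powr (1 / p)"
    by (rule Holder_sum) (use p in auto)
  also have "\<dots> = energy p q f powr ((p - 1) / p) * (\<Sum>j<L. row_energy q y j powr r) powr (1 / p)"
    by (simp add: square_energy[OF f] powr_powr)
  also have "\<dots> \<le> energy p q f powr ((p - 1) / p) * energy p q y powr (1 / p)"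
    unfolding energy_def[of _ _ y] using p
    by (intro mult_left_mono powr_mono2 sum_le_suminf energy_summable y sum_nonneg) auto
  also have "\<dots> = lplq_norm p q f powr (p - 1) * lplq_norm p q y"
    using p by (simp add: lplq_norm_eq powr_powr)
  finally show ?thesis .
qed

lemma exists_norming_functional:
  fixes f :: "nat \<Rightarrow> nat \<Rightarrow> 'k::real_normed_field"
  assumes f: "supported_in_square L f" and nz: "f \<noteq> 0"
  obtains F where "norming_functional p q f F"
    "\<And>j k. norm (F (unit_seq j k)) = lplq_norm p q f powr (1 - p) * weight p q f (j, k)"
proof -
  let ?u = "lplq_norm p q f"
  have flp: "f \<in> lplq p q" using f by (rule square_lplq)
  have u: "0 < ?u" using flp nz lplq_norm_pos by blast
  \<comment> \<open>The last factor is the unimodular one that makes \<open>c j k * f j k\<close>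
    nonnegative; where \<open>f j k = 0\<close> it is \<open>0\<close> by the convention on
    division, and so is the weight.\<close>
  define c :: "nat \<Rightarrow> nat \<Rightarrow> 'k" where
    "c j k = of_real (?u powr (1 - p) * weight p q f (j, k)) * (of_real (norm (f j k)) / f j k)" for j k
  define F where "F y = (\<Sum>j<L. \<Sum>k<L. c j k * y j k)" for y
  have w0: "0 \<le> weight p q f e" for e by (simp add: weight_def)
  have c: "norm (c j k) = ?u powr (1 - p) * weight p q f (j, k)" for j k
    using w0 by (cases "f j k = 0") (simp_all add: c_def norm_mult norm_divide weight_def)
  have bound: "norm (F y) \<le> lplq_norm p q y" if y: "y \<in> lplq p q" for y
  proof -
    have "norm (F y) \<le> (\<Sum>j<L. \<Sum>k<L. norm (c j k * y j k))"
      unfolding F_def by (intro order_trans[OF norm_sum] sum_mono norm_sum)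
    also have "\<dots> = ?u powr (1 - p) * (\<Sum>j<L. \<Sum>k<L. weight p q f (j, k) * norm (y j k))"
      by (simp add: norm_mult c sum_distrib_left mult.assoc)
    also have "\<dots> \<le> ?u powr (1 - p) * (?u powr (p - 1) * lplq_norm p q y)"
      by (intro mult_left_mono weighted_sum_le f y) auto
    also have "\<dots> = lplq_norm p q y"
      using u by (simp add: mult.assoc[symmetric] powr_add[symmetric])
    finally show ?thesis .
  qed
  have Ff: "F f = of_real ?u"
  proof -
    have "c j k * f j k = of_real (?u powr (1 - p) * (row_energy q f j powr (r - 1) * norm (f j k) powr q))" for j k
      using powr_mult_base[of "norm (f j k)" "q - 1"]
      by (cases "f j k = 0") (simp_all add: c_def weight_def mult_ac flip: of_real_mult)
    then have "F f = of_real (?u powr (1 - p) * (\<Sum>j<L. row_energy q f j powr (r - 1) * (\<Sum>k<L. norm (f j k) powr q)))"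
      by (simp add: F_def sum_distrib_left)
    also have "(\<Sum>j<L. row_energy q f j powr (r - 1) * (\<Sum>k<L. norm (f j k) powr q))
       = (\<Sum>j<L. row_energy q f j powr r)"
    proof (rule sum.cong[OF refl])
      fix j
      show "row_energy q f j powr (r - 1) * (\<Sum>k<L. norm (f j k) powr q) = row_energy q f j powr r"
        using powr_mult_base[of "row_energy q f j" "r - 1"] row_energy_nonneg[OF flp, of j]
        by (simp add: square_row_energy[OF f, symmetric] mult.commute)
    qed
    also have "\<dots> = ?u powr p" by (simp add: square_energy[OF f, symmetric] energy_eq_norm_powr[OF flp])
    also have "?u powr (1 - p) * ?u powr p = ?u" using u by (simp flip: powr_add)
    finally show ?thesis .
  qed
  have "F \<in> lplq_dual p q"
    unfolding lplq_dual_def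
  proof (intro CollectI conjI ballI allI exI[of _ 1])
    show "F (x + y) = F x + F y" for x y
      by (simp add: F_def distrib_left sum.distrib)
    show "F (dscale a x) = a * F x" for a x
      by (simp add: F_def dscale_def sum_distrib_left mult_ac)
  qed (use bound in auto)
  moreover have "lplq_dual_norm p q F = 1"
    unfolding lplq_dual_norm_def
  proof (rule cSup_eq_maximum)
    let ?g = "dscale (of_real (1 / ?u)) f"
    have "F ?g = of_real (1 / ?u) * F f"
      by (simp add: F_def dscale_def sum_distrib_left mult_ac)
    then have "norm (F ?g) = 1" using u by (simp add: Ff norm_mult norm_divide)
    moreover have "?g \<in> lplq p q" "lplq_norm p q ?g = 1"
      using dscale_lplq_norm[OF flp, of "of_real (1 / ?u)"] u by (simp_all add: norm_divide)
    ultimately show "1 \<in> (\<lambda>x. norm (F x)) ` {x \<in> lplq p q. lplq_norm p q x \<le> 1}"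
      by (intro image_eqI[of _ _ ?g]) auto
    show "z \<le> 1" if "z \<in> (\<lambda>x. norm (F x)) ` {x \<in> lplq p q. lplq_norm p q x \<le> 1}" for z
      using that bound by (auto intro: order_trans)
  qed
  ultimately have "norming_functional p q f F" using Ff by (simp add: norming_functional_def)
  moreover have "norm (F (unit_seq j k)) = ?u powr (1 - p) * weight p q f (j, k)" for j k
  proof -
    have "c j k = 0" if "\<not> (j < L \<and> k < L)"
      using that f by (auto simp: c_def supported_in_square_def)
    moreover have "(\<Sum>k'<L. c j' k' * unit_seq j k j' k') = (if j' = j then if k < L then c j k else 0 else 0)" for j'
    proof -
      have "(\<Sum>k'<L. c j' k' * unit_seq j k j' k') = (\<Sum>k'<L. if k' = k then (if j' = j then c j k else 0) else 0)"
        by (intro sum.cong) (auto simp: unit_seq_def)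
      then show ?thesis by simp
    qed
    ultimately have "F (unit_seq j k) = c j k" unfolding F_def by auto
    then show ?thesis by (simp add: c)
  qed
  ultimately show thesis by (rule that)
qed

section \<open>Runs with prescribed initial picks\<close>

lemma exists_greedy_index:
  fixes f :: "nat \<Rightarrow> nat \<Rightarrow> 'k::real_normed_field"
  assumes "supported_in_square L f"
  shows "\<exists>e. greedy_index p q f e"
proof -
  \<comment> \<open>Weights vanish off the square, so they take finitely many values and attain a
    maximum. The case \<open>f = 0\<close> is included, as picks are defined even after the
    remainder vanishes.\<close>
  have "weight p q f e = 0" if "e \<notin> {..<L} \<times> {..<L}" for e
    using assms that by (cases e) (auto simp: weight_def supported_in_square_def)
  then have "range (weight p q f) \<subseteq> insert 0 (weight p q f ` ({..<L} \<times> {..<L}))" by blast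
  then have fin: "finite (range (weight p q f))" by (rule finite_subset) simp
  then have "Max (range (weight p q f)) \<in> range (weight p q f)" by (intro Max_in) auto
  then obtain e where "weight p q f e = Max (range (weight p q f))" by auto
  then show ?thesis unfolding greedy_index_def using fin by (metis Max_ge rangeI)
qed

text \<open>The Lebesgue inequality speaks of infinite runs, so a greedy prefix \<open>e\<close>
  must be continued; beyond it any greedy index of the current remainder is taken.\<close>

lemma wcga_run_with_prefix:
  fixes x :: "nat \<Rightarrow> nat \<Rightarrow> 'k::real_normed_field"
  assumes x: "supported_in_square L x" and \<tau>: "0 < \<tau>" "\<tau> \<le> 1"
    and greedy: "\<And>i. i < m \<Longrightarrow> greedy_index p q (delete (e ` {..<i}) x) (e i)"
  obtains \<phi> G where "wcga_run p q canonical_basis \<tau> x \<phi> G" "x - G m = delete (e ` {..<m}) x"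
proof -
  define pick where "pick n \<Gamma> = (if n < m then e n else SOME e. greedy_index p q (delete \<Gamma> x) e)" for n \<Gamma>
  define \<Gamma> where "\<Gamma> = rec_nat {} (\<lambda>n \<Gamma>. insert (pick n \<Gamma>) \<Gamma>)"
  have \<Gamma>_simps: "\<Gamma> 0 = {}" "\<And>n. \<Gamma> (Suc n) = insert (pick n (\<Gamma> n)) (\<Gamma> n)"
    by (simp_all add: \<Gamma>_def)
  have \<Gamma>_prefix: "\<Gamma> n = e ` {..<n}" if "n \<le> m" for n
    using that by (induction n) (auto simp: \<Gamma>_simps pick_def lessThan_Suc)
  have \<Gamma>_eq: "\<Gamma> n = (\<lambda>i. pick i (\<Gamma> i)) ` {..<n}" for n
    by (induction n) (auto simp: \<Gamma>_simps lessThan_Suc)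
  have pick: "greedy_index p q (delete (\<Gamma> n) x) (pick n (\<Gamma> n))" for n
  proof (cases "n < m")
    case True
    then show ?thesis using greedy \<Gamma>_prefix by (simp add: pick_def)
  next
    case False
    then show ?thesis
      using exists_greedy_index[OF supported_in_square_delete[OF x]] by (simp add: pick_def someI_ex)
  qed
  define \<phi> :: "nat \<Rightarrow> nat \<Rightarrow> nat \<Rightarrow> 'k" where "\<phi> n = unit_vec (pick n (\<Gamma> n))" for n
  define G where "G n = x - delete (\<Gamma> n) x" for n
  have rem: "x - G n = delete (\<Gamma> n) x" for n by (simp add: G_def)
  have fin: "finite (\<Gamma> n)" for n by (subst \<Gamma>_eq) simp
  have "wcga_run p q canonical_basis \<tau> x \<phi> G"
    unfolding wcga_run_def
  proof (intro conjI allI)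
    show "G 0 = 0" by (simp add: G_def \<Gamma>_simps)
    fix n
    have span: "unit_vec ` \<Gamma> (Suc n) = \<phi> ` {..n}"
      by (subst \<Gamma>_eq) (simp add: \<phi>_def image_image lessThan_Suc_atMost)
    have greedy_step: "\<exists>F. norming_functional p q (x - G n) F \<and> \<tau> * (SUP \<psi>\<in>canonical_basis. norm (F \<psi>)) \<le> norm (F (\<phi> n))"
      if "x - G n \<noteq> 0"
    proof -
      obtain F where F: "norming_functional p q (delete (\<Gamma> n) x) F"
        "\<And>j k. norm (F (unit_seq j k)) = lplq_norm p q (delete (\<Gamma> n) x) powr (1 - p) * weight p q (delete (\<Gamma> n) x) (j, k)"
        using exists_norming_functional[OF supported_in_square_delete[OF x], of "\<Gamma> n"] \<open>x - G n \<noteq> 0\<close> rem by metis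
      have "(SUP \<psi>\<in>canonical_basis. norm (F \<psi>)) \<le> norm (F (\<phi> n))"
      proof (rule cSUP_least)
        show "canonical_basis \<noteq> ({} :: (nat \<Rightarrow> nat \<Rightarrow> 'k) set)" by (auto simp: canonical_basis_def)
        fix \<psi> :: "nat \<Rightarrow> nat \<Rightarrow> 'k" assume "\<psi> \<in> canonical_basis"
        then obtain j k where "\<psi> = unit_seq j k" by (auto simp: canonical_basis_def)
        then show "norm (F \<psi>) \<le> norm (F (\<phi> n))"
          using pick[of n] by (simp add: F(2) \<phi>_def greedy_index_def mult_left_mono)
      qed
      then have "\<tau> * (SUP \<psi>\<in>canonical_basis. norm (F \<psi>)) \<le> \<tau> * norm (F (\<phi> n))"
        using \<tau> by (intro mult_left_mono) auto
      also have "\<dots> \<le> 1 * norm (F (\<phi> n))" using \<tau> by (intro mult_right_mono) auto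
      finally show ?thesis using F(1) rem by auto
    qed
    show "if x - G n = 0 then G (Suc n) = G n
      else \<phi> n \<in> canonical_basis \<and>
        (\<exists>F. norming_functional p q (x - G n) F \<and> \<tau> * (SUP \<psi>\<in>canonical_basis. norm (F \<psi>)) \<le> norm (F (\<phi> n))) \<and>
        G (Suc n) \<in> dspan (\<phi> ` {..n}) \<and>
        lplq_norm p q (x - G (Suc n)) = lplq_dist p q x (dspan (\<phi> ` {..n}))"
    proof (cases "x - G n = 0")
      case True
      \<comment> \<open>Deleting a further entry from a zero remainder changes nothing, so
        \<open>G\<close> stays constant as a run demands.\<close>
      then have z: "delete (\<Gamma> n) x = 0" by (simp only: rem)
      have "delete (\<Gamma> (Suc n)) x = delete (\<Gamma> (Suc n)) (delete (\<Gamma> n) x)"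
        by (simp add: delete_delete \<Gamma>_simps insert_absorb Un_absorb2 subset_insertI)
      also have "\<dots> = delete (\<Gamma> n) x" unfolding z by (simp add: delete_def fun_eq_iff)
      finally show ?thesis using True by (simp add: G_def)
    next
      case False
      have "\<phi> n \<in> canonical_basis" unfolding \<phi>_def by (rule unit_vec_in_basis)
      moreover have "G (Suc n) \<in> dspan (\<phi> ` {..n})"
        using minus_delete_in_span[OF fin[of "Suc n"], of x] unfolding span G_def .
      moreover have "lplq_norm p q (x - G (Suc n)) = lplq_dist p q x (dspan (\<phi> ` {..n}))"
        using dist_span[OF square_lplq[OF x] fin[of "Suc n"]] unfolding span rem by simp
      ultimately show ?thesis using False greedy_step by simp
    qed
  qed
  moreover have "x - G m = delete (e ` {..<m}) x" by (simp add: rem \<Gamma>_prefix)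
  ultimately show thesis by (rule that)
qed

text \<open>The form used on examples: a prescribed greedy sequence of picks is played against a
  hand-picked \<open>A\<close>, in \<open>p\<close>-th powers.\<close>

lemma wcga_lebesgue_prefix:
  fixes x :: "nat \<Rightarrow> nat \<Rightarrow> 'k::real_normed_field"
  assumes leb: "wcga_lebesgue TYPE('k) p q \<tau> \<psi> C" and \<tau>: "0 < \<tau>" "\<tau> \<le> 1" and C: "0 < C" and N: "1 \<le> N"
    and x: "supported_in_square L x"
    and greedy: "\<And>i. i < \<psi> N \<Longrightarrow> greedy_index p q (delete (e ` {..<i}) x) (e i)"
    and A: "finite A" "card A \<le> N"
  shows "energy p q (delete (e ` {..<\<psi> N}) x) \<le> C powr p * energy p q (delete A x)"
proof -
  obtain \<phi> G where run: "wcga_run p q canonical_basis \<tau> x \<phi> G" "x - G (\<psi> N) = delete (e ` {..<\<psi> N}) x"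
    using wcga_run_with_prefix[OF x \<tau> greedy] by blast
  have xl: "x \<in> lplq p q" by (rule square_lplq[OF x])
  have "lplq_norm p q (x - G (\<psi> N)) \<le> C * best_error p q canonical_basis N x"
    using leb N xl run(1) unfolding wcga_lebesgue_def by blast
  also have "\<dots> \<le> C * lplq_norm p q (delete A x)"
    using best_error_le[OF xl A] C by (intro mult_left_mono) auto
  finally have "lplq_norm p q (x - G (\<psi> N)) powr p \<le> (C * lplq_norm p q (delete A x)) powr p"
    using p lplq_norm_nonneg by (intro powr_mono2) auto
  then show ?thesis
    using C lplq_norm_nonneg[of p q "delete A x"]
    by (simp add: run(2) energy_eq_norm_powr[OF delete_lplq[OF xl]] powr_mult)
qed

section \<open>The comb examples\<close>

lemma row_energy_flat:
  assumes "finite K" "\<And>k. x j k = (if k \<in> K then v else 0)"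
  shows "row_energy q x j = real (card K) * norm v powr q"
proof -
  have "row_energy q x j = (\<Sum>k\<in>K. norm (x j k) powr q)"
    unfolding row_energy_def by (rule suminf_finite) (use assms q in auto)
  then show ?thesis by (simp add: assms(2))
qed

lemma weight_flat:
  assumes "finite K" "\<And>k. x j k = (if k \<in> K then v else 0)"
  shows "weight p q x (j, k) = (if k \<in> K then real (card K) powr (r - 1) * norm v powr (p - 1) else 0)"
proof -
  have "(norm v powr q) powr (r - 1) * norm v powr (q - 1) = norm v powr (p - 1)"
    using q by (simp add: powr_powr right_diff_distrib flip: powr_add)
  moreover have "row_energy q x j = real (card K) * norm v powr q"
    by (rule row_energy_flat) (use assms in auto)
  ultimately show ?thesis
    using q by (simp add: weight_def assms(2) powr_mult mult.assoc)
qed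

text \<open>
  Every tooth has \<open>weight\<close> \<open>1\<close>; \<open>\<alpha>\<close> is chosen below so that the prescribed picks still have maximal
  weight while the set that the best approximation deletes carries almost all of the energy.
\<close>

definition comb :: "real \<Rightarrow> nat \<Rightarrow> nat \<Rightarrow> nat \<Rightarrow> nat \<Rightarrow> 'k::real_normed_field" where
  "comb \<alpha> s t = (\<lambda>j k. if j = 0 then if k < s then of_real \<alpha> else 0
     else if j \<le> t \<and> k = 0 then 1 else 0)"

lemma comb_supported: "supported_in_square (Suc (max s t)) (comb \<alpha> s t)"
  by (auto simp: supported_in_square_def comb_def split: if_splits)

lemma energy_teeth:
  "energy p q (delete ({0} \<times> {..<s}) (comb \<alpha> s t :: nat \<Rightarrow> nat \<Rightarrow> 'k::real_normed_field)) = real t"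
proof -
  let ?x = "delete ({0} \<times> {..<s}) (comb \<alpha> s t :: nat \<Rightarrow> nat \<Rightarrow> 'k)"
  have "row_energy q ?x j = real (card (if 1 \<le> j \<and> j \<le> t then {0::nat} else {})) * norm (1::'k) powr q" for j
    by (rule row_energy_flat) (auto simp: delete_def comb_def)
  then have row: "row_energy q ?x j = (if 1 \<le> j \<and> j \<le> t then 1 else 0)" for j by simp
  have "energy p q ?x = (\<Sum>j\<in>{1..t}. row_energy q ?x j powr r)"
    unfolding energy_def by (rule suminf_finite) (auto simp: row)
  then show ?thesis by (simp add: row)
qed

lemma energy_handle:
  assumes "0 \<le> \<alpha>"
  shows "energy p q (delete ({1..t} \<times> {0}) (comb \<alpha> s t :: nat \<Rightarrow> nat \<Rightarrow> 'k::real_normed_field))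
    = real s powr r * \<alpha> powr p"
proof -
  let ?x = "delete ({1..t} \<times> {0}) (comb \<alpha> s t :: nat \<Rightarrow> nat \<Rightarrow> 'k)"
  have row0: "row_energy q ?x 0 = real (card {..<s}) * norm (of_real \<alpha> :: 'k) powr q"
    by (rule row_energy_flat) (auto simp: delete_def comb_def)
  have row: "row_energy q ?x j = 0" if "j \<noteq> 0" for j
  proof -
    have "row_energy q ?x j = real (card ({} :: nat set)) * norm (0::'k) powr q"
      by (rule row_energy_flat) (use that in \<open>auto simp: delete_def comb_def\<close>)
    then show ?thesis by simp
  qed
  have "energy p q ?x = (\<Sum>j\<in>{0}. row_energy q ?x j powr r)"
    unfolding energy_def by (rule suminf_finite) (auto simp: row simp del: One_nat_def)
  then show ?thesis using assms q by (simp add: row0 powr_mult powr_powr del: One_nat_def)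
qed

text \<open>For a handle of length \<open>M\<close> with entries
  \<open>\<alpha> = M powr (- ((r - 1) / (p - 1)))\<close> the weight is \<open>1\<close>, and this
  is the exponent of \<open>M\<close> in its energy
  \<open>M powr r * \<alpha> powr p\<close>.\<close>

lemma exponent_identity: "r - (r - 1) / (p - 1) * p = conj_exp p / conj_exp q"
  using p q by (simp add: conj_exp_def field_simps)

text \<open>All weights tie at \<open>1\<close>, so the run may spend its \<open>\<psi> N\<close>
  steps on the teeth and leave the handle intact, while deleting the \<open>N\<close> handle entries
  leaves only energy \<open>\<psi> N\<close>.\<close>

lemma wcga_lower_teeth_first:
  assumes leb: "wcga_lebesgue TYPE('k::real_normed_field) p q \<tau> \<psi> C"
    and \<tau>: "0 < \<tau>" "\<tau> \<le> 1" and C: "0 < C" and N: "1 \<le> N"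
  shows "real N powr (conj_exp p / conj_exp q) \<le> C powr p * real (\<psi> N)"
proof -
  define \<alpha> where "\<alpha> = real N powr (- ((r - 1) / (p - 1)))"
  define x :: "nat \<Rightarrow> nat \<Rightarrow> 'k" where "x = comb \<alpha> N (\<psi> N)"
  define e :: "nat \<Rightarrow> nat \<times> nat" where "e i = (Suc i, 0)" for i
  have \<alpha>: "0 < \<alpha>" using N by (simp add: \<alpha>_def)
  have bal: "real N powr (r - 1) * \<alpha> powr (p - 1) = 1"
    using p N by (simp add: \<alpha>_def powr_powr flip: powr_add)
  have e_img: "e ` {..<n} = {1..n} \<times> {0}" for n
    by (auto simp: e_def image_iff Suc_le_eq gr0_conv_Suc)
  have greedy: "greedy_index p q (delete (e ` {..<i}) x) (e i)" if i: "i < \<psi> N" for i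
  proof -
    let ?f = "delete (e ` {..<i}) x"
    have handle: "weight p q ?f (0, k) =
        (if k \<in> {..<N} then real (card {..<N}) powr (r - 1) * norm (of_real \<alpha> :: 'k) powr (p - 1) else 0)" for k
      by (rule weight_flat) (auto simp: e_img x_def comb_def delete_def)
    have tooth: "weight p q ?f (j, k) = (if k \<in> (if i < j \<and> j \<le> \<psi> N then {0} else {})
        then real (card (if i < j \<and> j \<le> \<psi> N then {0::nat} else {})) powr (r - 1) * norm (1 :: 'k) powr (p - 1) else 0)"
      if "j \<noteq> 0" for j k
      by (rule weight_flat) (use that in \<open>auto simp: e_img x_def comb_def delete_def\<close>)
    have "weight p q ?f (j, k) \<le> 1" for j k
      using handle[of k] tooth[of j k] bal \<alpha> by (cases "j = 0") auto
    moreover have "weight p q ?f (e i) = 1"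
      using tooth[of "Suc i" 0] i by (simp add: e_def)
    ultimately show ?thesis by (auto simp: greedy_index_def)
  qed
  have "energy p q (delete (e ` {..<\<psi> N}) x) \<le> C powr p * energy p q (delete ({0} \<times> {..<N}) x)"
    by (rule wcga_lebesgue_prefix[OF leb \<tau> C N _ greedy])
      (use comb_supported in \<open>auto simp: x_def card_cartesian_product\<close>)
  then have "real N powr r * \<alpha> powr p \<le> C powr p * real (\<psi> N)"
    using \<alpha> by (simp add: e_img x_def energy_handle energy_teeth del: One_nat_def)
  moreover have "real N powr r * \<alpha> powr p = real N powr (conj_exp p / conj_exp q)"
    by (simp add: \<alpha>_def powr_powr exponent_identity[symmetric] flip: powr_add)
  ultimately show ?thesis by simp
qed

text \<open>The run spends its \<open>\<psi> N\<close> steps on half of the handle and leaves all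
  \<open>N\<close> teeth, while deleting the teeth leaves only the handle.\<close>

lemma wcga_lower_handle_first:
  assumes leb: "wcga_lebesgue TYPE('k::real_normed_field) p q \<tau> \<psi> C"
    and \<tau>: "0 < \<tau>" "\<tau> \<le> 1" and C: "0 < C" and N: "1 \<le> N" and qp: "q \<le> p"
  shows "real N \<le> C powr p * 2 powr r * real (\<psi> N) powr (conj_exp p / conj_exp q)"
proof -
  define m where "m = \<psi> N"
  \<comment> \<open>Calibrated for length \<open>m\<close>, half of the handle: before each
    prescribed pick at least \<open>m\<close> handle entries remain, so by \<open>r \<ge> 1\<close>
    their weight is at least that of a tooth. If \<open>m = 0\<close>, then
    \<open>\<alpha> = 0\<close>.\<close>
  define \<alpha> where "\<alpha> = real m powr (- ((r - 1) / (p - 1)))"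
  define x :: "nat \<Rightarrow> nat \<Rightarrow> 'k" where "x = comb \<alpha> (2 * m) N"
  define e :: "nat \<Rightarrow> nat \<times> nat" where "e i = (0, i)" for i
  have r: "1 \<le> r" using qp q by simp
  have \<alpha>: "0 \<le> \<alpha>" by (simp add: \<alpha>_def)
  have e_img: "e ` {..<n} = {0} \<times> {..<n}" for n by (auto simp: e_def)
  have greedy: "greedy_index p q (delete (e ` {..<i}) x) (e i)" if i: "i < \<psi> N" for i
  proof -
    let ?f = "delete (e ` {..<i}) x"
    have handle: "weight p q ?f (0, k) =
        (if k \<in> {i..<2 * m} then real (card {i..<2 * m}) powr (r - 1) * norm (of_real \<alpha> :: 'k) powr (p - 1) else 0)" for k
      by (rule weight_flat) (auto simp: e_img x_def comb_def delete_def)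
    have tooth: "weight p q ?f (j, k) = (if k \<in> (if j \<le> N then {0} else {})
        then real (card (if j \<le> N then {0::nat} else {})) powr (r - 1) * norm (1 :: 'k) powr (p - 1) else 0)"
      if "j \<noteq> 0" for j k
      by (rule weight_flat) (use that in \<open>auto simp: e_img x_def comb_def delete_def\<close>)
    have "1 = real m powr (r - 1) * \<alpha> powr (p - 1)"
      using p i by (simp add: \<alpha>_def powr_powr m_def flip: powr_add)
    also have "\<dots> \<le> real (2 * m - i) powr (r - 1) * \<alpha> powr (p - 1)"
      using r i by (intro mult_right_mono powr_mono2) (auto simp: m_def)
    also have "\<dots> = weight p q ?f (e i)"
      using handle[of i] i \<alpha> by (simp add: e_def m_def)
    finally have ge: "1 \<le> weight p q ?f (e i)" .
    have "weight p q ?f (0, k) \<le> weight p q ?f (e i)" for k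
      using handle[of k] handle[of i] i by (simp add: e_def m_def)
    moreover have "weight p q ?f (j, k) \<le> 1" if "j \<noteq> 0" for j k
      using tooth[OF that, of k] by (auto split: if_splits)
    ultimately have "weight p q ?f (j, k) \<le> weight p q ?f (e i)" for j k
      using ge by (cases "j = 0") (auto intro: order_trans)
    then show ?thesis by (auto simp: greedy_index_def)
  qed
  have xs: "supported_in_square (Suc (max (2 * m) N)) x" unfolding x_def by (rule comb_supported)
  have xl: "x \<in> lplq p q" using xs by (rule square_lplq)
  have "real N = energy p q (delete ({0} \<times> {..<2 * m}) x)" by (simp add: x_def energy_teeth)
  also have "\<dots> \<le> energy p q (delete (e ` {..<\<psi> N}) x)"
    by (rule energy_mono[OF delete_lplq[OF xl]]) (auto simp: delete_def e_img m_def)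
  also have "\<dots> \<le> C powr p * energy p q (delete ({1..N} \<times> {0}) x)"
    by (rule wcga_lebesgue_prefix[OF leb \<tau> C N xs greedy]) (auto simp: card_cartesian_product)
  also have "energy p q (delete ({1..N} \<times> {0}) x) = real (2 * m) powr r * \<alpha> powr p"
    unfolding x_def by (rule energy_handle[OF \<alpha>])
  also have "\<dots> = 2 powr r * (real m powr r * \<alpha> powr p)" by (simp add: powr_mult)
  also have "real m powr r * \<alpha> powr p = real m powr (conj_exp p / conj_exp q)"
    by (simp add: \<alpha>_def powr_powr exponent_identity[symmetric] flip: powr_add)
  finally show ?thesis by (simp add: m_def mult.assoc)
qed

lemma wcga_lebesgue_lower:
  assumes leb: "wcga_lebesgue TYPE('k::real_normed_field) p q \<tau> \<psi> C"
    and \<tau>: "0 < \<tau>" "\<tau> \<le> 1" and C: "0 < C"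
  shows "\<exists>c'>0. \<forall>N\<ge>1. c' * real N powr wcga_beta p q \<le> real (\<psi> N)"
proof -
  have cpos: "0 < conj_exp p" "0 < conj_exp q" using p q by (simp_all add: conj_exp_def)
  show ?thesis
  proof (cases "q \<le> p")
    case True
    then have "conj_exp p \<le> conj_exp q" using p q by (simp add: conj_exp_def field_simps)
    then have \<beta>: "wcga_beta p q = conj_exp q / conj_exp p"
      using cpos by (simp add: wcga_beta_eq dual_max_def dual_min_def)
    define D where "D = C powr p * 2 powr r"
    have D: "0 < D" using C by (simp add: D_def)
    show ?thesis
    \<comment> \<open>The example bounds \<open>N\<close> by a power of \<open>\<psi> N\<close> with
      exponent \<open>1 / \<beta>\<close>; raising to the power \<open>\<beta>\<close> inverts
      it.\<close>
    proof (intro exI[of _ "(1 / D) powr wcga_beta p q"] conjI allI impI)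
      fix N :: nat assume N: "1 \<le> N"
      have "real N \<le> D * real (\<psi> N) powr (conj_exp p / conj_exp q)"
        using wcga_lower_handle_first[OF leb \<tau> C N True] by (simp add: D_def)
      then have le: "1 / D * real N \<le> real (\<psi> N) powr (conj_exp p / conj_exp q)"
        using D by (simp add: field_simps)
      have "(1 / D) powr wcga_beta p q * real N powr wcga_beta p q = (1 / D * real N) powr wcga_beta p q"
        using D by (subst powr_mult) auto
      also have "\<dots> \<le> (real (\<psi> N) powr (conj_exp p / conj_exp q)) powr wcga_beta p q"
        using D wcga_beta_ge_1 le by (intro powr_mono2) auto
      also have "\<dots> = real (\<psi> N)" using cpos by (simp add: powr_powr \<beta>)
      finally show "(1 / D) powr wcga_beta p q * real N powr wcga_beta p q \<le> real (\<psi> N)" .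
    qed (use D in simp)
  next
    case False
    then have "conj_exp q \<le> conj_exp p" using p q by (simp add: conj_exp_def field_simps)
    then have \<beta>: "wcga_beta p q = conj_exp p / conj_exp q"
      by (simp add: wcga_beta_eq dual_max_def dual_min_def)
    show ?thesis
      using wcga_lower_teeth_first[OF leb \<tau> C] C
      by (intro exI[of _ "1 / C powr p"]) (simp add: \<beta> field_simps)
  qed
qed

end

theorem theorem1p16:
  fixes p q \<tau> :: real
  assumes "1 < p" and "1 < q" and "0 < \<tau>" and "\<tau> \<le> 1"
  shows
    "((\<exists>c>0. \<exists>C>0. wcga_lebesgue TYPE(real) p q \<tau>
          (\<lambda>N. nat \<lfloor>c * real N powr wcga_beta p q\<rfloor>) C) \<and>
      (\<forall>\<psi> C. C > 0 \<and> wcga_lebesgue TYPE(real) p q \<tau> \<psi> C \<longrightarrow>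
          (\<exists>c'>0. \<forall>N\<ge>1. real (\<psi> N) \<ge> c' * real N powr wcga_beta p q))) \<and>
     ((\<exists>c>0. \<exists>C>0. wcga_lebesgue TYPE(complex) p q \<tau>
          (\<lambda>N. nat \<lfloor>c * real N powr wcga_beta p q\<rfloor>) C) \<and>
      (\<forall>\<psi> C. C > 0 \<and> wcga_lebesgue TYPE(complex) p q \<tau> \<psi> C \<longrightarrow>
          (\<exists>c'>0. \<forall>N\<ge>1. real (\<psi> N) \<ge> c' * real N powr wcga_beta p q)))"
proof -
  interpret mixed_exponents p q by unfold_locales (use assms in auto)
  show ?thesis
    by (intro conjI allI impI wcga_lebesgue_upper[OF assms(3)]; elim conjE; rule wcga_lebesgue_lower[OF _ assms(3,4)])
qed

end
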